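(* Let $0<\nu\le\tfrac12$, $\lambda>0$, $k\in\mathbb{N}$, $\lambda_1,\dots,\lambda_k>0$. Let $M$ be the generalized counting process with parameters $\lambda_1,\dots,\lambda_k$, independent of the inverse process $\mathcal{L}^\nu$ of $H_1^{2\nu}(t)+(2\lambda)^{1/\nu}H_2^\nu(t)$; let $\tilde p_n^\nu(t)=\mathsf{P}\{M(\mathcal{L}^\nu(t))=n\}$ and $\tilde G_\nu(u,t)=\sum_{n=0}^\infty u^n\tilde p_n^\nu(t)$. Then for real $u$ with $|u|<1$, $\tilde G_\nu$ solves $$\frac{\partial^{2\nu}\tilde G_\nu(u,t)}{\partial t^{2\nu}}+2\lambda\frac{\partial^\nu\tilde G_\nu(u,t)}{\partial t^\nu}=-\sum_{j=1}^k\lambda_j(1-u^j)\,\tilde G_\nu(u,t),\qquad \tilde G_\nu(u,0)=1,$$ (Caputo–Djrbashian derivatives in $t$), and is given by $$\tilde G_\nu(u,t)=\tilde\ell_\nu\Big(\sum_{j=1}^k\lambda_j(1-u^j),\,t\Big),$$ where, for $\gamma>0$, with $r_1=-\lambda+\sqrt{\lambda^2-\gamma}$ and $r_2=-\lambda-\sqrt{\lambda^2-\gamma}$, $\tilde\ell_\nu(\gamma,t)=\mathsf{E}e^{-\gamma\mathcal{L}^\nu(t)}$ is given by $$\tilde\ell_\nu(\gamma,t)=\frac12\left[\left(1+\frac{\lambda}{\sqrt{\lambda^2-\gamma}}\right)E_{\nu,1}(r_1t^\nu)+\left(1-\frac{\lambda}{\sqrt{\lambda^2-\gamma}}\right)E_{\nu,1}(r_2t^\nu)\right]\quad(\gamma\ne\lambda^2),$$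 or, alternatively, by $$\tilde\ell_\nu(\gamma,t)=E_{\nu,1}^{1,1}(r_1t^\nu,r_2t^\nu)+2\lambda t^\nu E_{\nu,\nu+1}^{1,1}(r_1t^\nu,r_2t^\nu).$$
   Context: The generalized counting process $M(t)$, $t\ge0$, with parameters $\lambda_1,\dots,\lambda_k>0$ is the counting process ($\mathbb{N}_0$-valued) with $M(0)=0$ a.s., stationary and independent increments, $\mathsf{P}\{M(h)=j\}=\lambda_jh+o(h)$ for $j=1,\dots,k$, and $\mathsf{P}\{M(h)>k\}=o(h)$ as $h\downarrow 0$. For $\beta\in(0,1)$, a stable subordinator $H^{\beta}$ is a nondecreasing Lévy process with $\mathsf{E}e^{-sH^{\beta}(t)}=e^{-ts^{\beta}}$, $s>0$; for $\beta=1$ set $H^1(t)=t$. $H_1^{2\nu}$ and $H_2^\nu$ are independent stable subordinators of orders $2\nu$ and $\nu$. The inverse process is $\mathcal{L}^\nu(t)=\inf\{s>0: H_1^{2\nu}(s)+(2\lambda)^{1/\nu}H_2^\nu(s)\ge t\}$, $t>0$, $\mathcal{L}^\nu(0)=0$. The Caputo–Djrbashian derivative of order $\beta\in(0,1)$ is $\frac{d^{\beta}}{dt^{\beta}}u(t)=\frac{1}{\Gamma(1-\beta)}\int_0^t \frac{u'(s)}{(t-s)^{\beta}}\,ds$; for $\beta=1$ it is the ordinary derivative. Mittag-Leffler functions (entire, complex arguments allowed): $E_{\alpha,\beta}(z)=\sum_{r=0}^\infty\frac{z^r}{\Gamma(\alpha r+\beta)}$ and $$E_{\alpha,\beta}^{\gamma_1,\gamma_2}(z_1,z_2)=\sum_{k_1=0}^\infty\sum_{k_2=0}^\infty\frac{(\gamma_1)_{k_1}(\gamma_2)_{k_2}}{\Gamma(\alpha(k_1+k_2)+\beta)}\frac{z_1^{k_1}}{k_1!}\frac{z_2^{k_2}}{k_2!},$$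 with $(\gamma)_0=1$, $(\gamma)_r=\gamma(\gamma+1)\cdots(\gamma+r-1)$. Square roots of negative numbers are complex square roots; either choice may be used, since the expressions are symmetric under changing its sign. *)

theory Defs
  imports "HOL-Probability.Probability" "HOL-Library.Landau_Symbols"
begin

text \<open>
  Stochastic processes are functions of a real time parameter and a sample point; only times
  \<open>t \<ge> 0\<close> are meaningful, and nothing is required of a process at negative times.
\<close>

definition independent_increments :: "'a measure \<Rightarrow> (real \<Rightarrow> 'a \<Rightarrow> real) \<Rightarrow> bool" where
  "independent_increments P X \<longleftrightarrow>
     (\<forall>(n::nat) (\<tau> :: nat \<Rightarrow> real). 0 \<le> \<tau> 0 \<and> mono_on {..n} \<tau> \<longrightarrow>
        prob_space.indep_vars P (\<lambda>_. borel) (\<lambda>i \<omega>. X (\<tau> (Suc i)) \<omega> - X (\<tau> i) \<omega>) {..<n})"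

definition stationary_increments :: "'a measure \<Rightarrow> (real \<Rightarrow> 'a \<Rightarrow> real) \<Rightarrow> bool" where
  "stationary_increments P X \<longleftrightarrow>
     (\<forall>s\<ge>0. \<forall>t\<ge>0. distr P borel (\<lambda>\<omega>. X (s + t) \<omega> - X s \<omega>) =
                    distr P borel (\<lambda>\<omega>. X t \<omega> - X 0 \<omega>))"

definition independent_processes ::
    "'a measure \<Rightarrow> (real \<Rightarrow> 'a \<Rightarrow> real) \<Rightarrow> (real \<Rightarrow> 'a \<Rightarrow> real) \<Rightarrow> bool" where
  "independent_processes P X Y \<longleftrightarrow>
     prob_space.indep_var P
       (PiM {0..} (\<lambda>_. borel)) (\<lambda>\<omega>. \<lambda>t\<in>{0..}. X t \<omega>)
       (PiM {0..} (\<lambda>_. borel)) (\<lambda>\<omega>. \<lambda>t\<in>{0..}. Y t \<omega>)"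

definition levy_process :: "'a measure \<Rightarrow> (real \<Rightarrow> 'a \<Rightarrow> real) \<Rightarrow> bool" where
  "levy_process P X \<longleftrightarrow>
     (\<forall>t\<ge>0. X t \<in> borel_measurable P) \<and>
     (AE \<omega> in P. X 0 \<omega> = 0) \<and>
     independent_increments P X \<and>
     stationary_increments P X \<and>
     (\<forall>t\<ge>0. \<forall>\<epsilon>>0.
        ((\<lambda>s. measure P {\<omega> \<in> space P. \<bar>X s \<omega> - X t \<omega>\<bar> > \<epsilon>}) \<longlongrightarrow> 0) (at t within {0..})) \<and>
     (AE \<omega> in P. (\<forall>t\<ge>0. continuous (at_right t) (\<lambda>s. X s \<omega>)) \<and>
                 (\<forall>t>0. \<exists>l. ((\<lambda>s. X s \<omega>) \<longlongrightarrow> l) (at_left t)))"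

definition stable_subordinator :: "'a measure \<Rightarrow> real \<Rightarrow> (real \<Rightarrow> 'a \<Rightarrow> real) \<Rightarrow> bool" where
  "stable_subordinator P \<beta> H \<longleftrightarrow>
     (if \<beta> = 1 then (\<forall>t\<ge>0. \<forall>\<omega>\<in>space P. H t \<omega> = t)
      else levy_process P H \<and>
           (AE \<omega> in P. mono_on {0..} (\<lambda>t. H t \<omega>)) \<and>
           (\<forall>t\<ge>0. \<forall>s>0. (\<integral>\<omega>. exp (- s * H t \<omega>) \<partial>P) = exp (- t * s powr \<beta>)))"

text \<open>
  Right-continuity and monotonicity of the paths of a counting process hold for every sample
  point, which makes a counting process evaluated at a nonnegative random time a random variable
  without completing the probability space.
\<close>

definition counting_process :: "'a measure \<Rightarrow> (real \<Rightarrow> 'a \<Rightarrow> nat) \<Rightarrow> bool" where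
  "counting_process P M \<longleftrightarrow>
     (\<forall>t\<ge>0. M t \<in> measurable P (count_space UNIV)) \<and>
     (\<forall>\<omega>\<in>space P. mono_on {0..} (\<lambda>t. M t \<omega>) \<and>
                 (\<forall>t\<ge>0. continuous (at_right t) (\<lambda>s. real (M s \<omega>))))"

definition generalized_counting_process ::
    "'a measure \<Rightarrow> nat \<Rightarrow> (nat \<Rightarrow> real) \<Rightarrow> (real \<Rightarrow> 'a \<Rightarrow> nat) \<Rightarrow> bool" where
  "generalized_counting_process P k rate M \<longleftrightarrow>
     counting_process P M \<and>
     (AE \<omega> in P. M 0 \<omega> = 0) \<and>
     independent_increments P (\<lambda>t \<omega>. real (M t \<omega>)) \<and>
     stationary_increments P (\<lambda>t \<omega>. real (M t \<omega>)) \<and>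
     (\<forall>j\<in>{1..k}. (\<lambda>h. measure P {\<omega> \<in> space P. M h \<omega> = j} - rate j * h) \<in> o[at_right 0](\<lambda>h. h)) \<and>
     (\<lambda>h. measure P {\<omega> \<in> space P. M h \<omega> > k}) \<in> o[at_right 0](\<lambda>h. h)"

text \<open>
  For \<open>t > 0\<close> the set of passage times is nonempty almost surely; on the exceptional event, where
  the infimum of the empty set is arbitrary in \<open>real\<close>, the inverse process is set to \<open>0\<close>.
\<close>

definition inverse_process ::
    "real \<Rightarrow> real \<Rightarrow> (real \<Rightarrow> 'a \<Rightarrow> real) \<Rightarrow> (real \<Rightarrow> 'a \<Rightarrow> real) \<Rightarrow> real \<Rightarrow> 'a \<Rightarrow> real" where
  "inverse_process \<nu> lam H1 H2 t \<omega> =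
     (let S = {s. s > 0 \<and> H1 s \<omega> + (2 * lam) powr (1 / \<nu>) * H2 s \<omega> \<ge> t}
      in if t = 0 \<or> S = {} then 0 else Inf S)"

definition time_changed_prob ::
    "'a measure \<Rightarrow> (real \<Rightarrow> 'a \<Rightarrow> nat) \<Rightarrow> (real \<Rightarrow> 'a \<Rightarrow> real) \<Rightarrow> nat \<Rightarrow> real \<Rightarrow> real" where
  "time_changed_prob P M L n t = measure P {\<omega> \<in> space P. M (L t \<omega>) \<omega> = n}"

definition time_changed_pgf ::
    "'a measure \<Rightarrow> (real \<Rightarrow> 'a \<Rightarrow> nat) \<Rightarrow> (real \<Rightarrow> 'a \<Rightarrow> real) \<Rightarrow> real \<Rightarrow> real \<Rightarrow> real" where
  "time_changed_pgf P M L u t = (\<Sum>n. u ^ n * time_changed_prob P M L n t)"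

definition laplace_process :: "'a measure \<Rightarrow> (real \<Rightarrow> 'a \<Rightarrow> real) \<Rightarrow> real \<Rightarrow> real \<Rightarrow> real" where
  "laplace_process P L \<gamma> t = (\<integral>\<omega>. exp (- \<gamma> * L t \<omega>) \<partial>P)"

definition caputo_deriv :: "real \<Rightarrow> (real \<Rightarrow> real) \<Rightarrow> real \<Rightarrow> real" where
  "caputo_deriv \<beta> f t =
     (if \<beta> = 1 then deriv f t
      else 1 / Gamma (1 - \<beta>) * (LINT s:{0<..<t}|lborel. deriv f s / (t - s) powr \<beta>))"

text \<open>
  The condition under which \<open>caputo_deriv \<beta> f t\<close> is meaningful: \<open>deriv\<close> and the Lebesgue
  integral are total functions in HOL. Continuity on \<open>{0..t}\<close> ties the derivative,
  which only involves positive times, to the initial value at time \<open>0\<close>.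
\<close>

definition caputo_differentiable :: "real \<Rightarrow> (real \<Rightarrow> real) \<Rightarrow> real \<Rightarrow> bool" where
  "caputo_differentiable \<beta> f t \<longleftrightarrow>
     continuous_on {0..t} f \<and>
     (if \<beta> = 1 then f differentiable (at t)
      else (\<forall>s\<in>{0<..<t}. f differentiable (at s)) \<and>
           set_integrable lborel {0<..<t} (\<lambda>s. deriv f s / (t - s) powr \<beta>))"

definition mittag_leffler :: "real \<Rightarrow> real \<Rightarrow> complex \<Rightarrow> complex" where
  "mittag_leffler \<alpha> \<beta> z = (\<Sum>r. z ^ r / Gamma (of_real (\<alpha> * real r + \<beta>)))"

definition mittag_leffler2 ::
    "real \<Rightarrow> real \<Rightarrow> complex \<Rightarrow> complex \<Rightarrow> complex \<Rightarrow> complex \<Rightarrow> complex" where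
  "mittag_leffler2 \<alpha> \<beta> \<gamma>1 \<gamma>2 z1 z2 =
     (\<Sum>k1. \<Sum>k2. pochhammer \<gamma>1 k1 * pochhammer \<gamma>2 k2 / Gamma (of_real (\<alpha> * real (k1 + k2) + \<beta>))
        * (z1 ^ k1 / fact k1) * (z2 ^ k2 / fact k2))"

end

theory Submission
  imports Defs
begin

text \<open>
  Everything rests on the function \<open>\<ell>(\<gamma>, t) = E exp (- \<gamma> L(t))\<close> of the inverse process \<open>L\<close>. The
  clock \<open>H = H\<^sub>1 + (2\<lambda>)\<^bsup>1/\<nu>\<^esup> H\<^sub>2\<close> has nondecreasing right-continuous paths, so \<open>L(t) \<le> x\<close> is almost
  surely the same event as \<open>H(x) \<ge> t\<close>. Writing \<open>exp (- \<gamma> L)\<close> as an integral over \<open>x\<close> and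
  exchanging integrals expresses the Laplace transform of \<open>\<ell>(\<gamma>, \<cdot>)\<close> through \<open>E exp (- s H(x)) =
  exp (- x \<psi>(s))\<close> with \<open>\<psi>(s) = s\<^bsup>2\<nu>\<^esup> + 2\<lambda> s\<^bsup>\<nu>\<^esup>\<close>; the result is \<open>\<psi>(s) / (s (\<gamma> + \<psi>(s)))\<close>
  (\<open>laplace_first_passage\<close>).

  In terms of \<open>q = s\<^bsup>-\<nu>\<^esup>\<close> this is \<open>1/s\<close> times \<open>(1 + 2\<lambda>q) / (1 + 2\<lambda>q + \<gamma>q\<^sup>2) = \<Sum> c\<^sub>n q\<^sup>n\<close>, and
  since \<open>t\<^bsup>\<nu>n\<^esup> / \<Gamma>(\<nu>n + 1)\<close> has transform \<open>q\<^sup>n / s\<close>, the function \<open>\<Sum> c\<^sub>n t\<^bsup>\<nu>n\<^esup> / \<Gamma>(\<nu>n + 1)\<close> has the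
  same transform. A Laplace transform determines a left-continuous function
  (\<open>laplace_transform_zero_imp_zero\<close>, by Weierstrass approximation in the variable \<open>exp (- t)\<close>),
  so \<open>\<ell>(\<gamma>, \<cdot>)\<close> equals this series.

  The rest is read off from the coefficients, which satisfy \<open>c\<^sub>0 = 1\<close>, \<open>c\<^sub>1 = 0\<close> and
  \<open>c\<^sub>n\<^sub>+\<^sub>2 + 2\<lambda> c\<^sub>n\<^sub>+\<^sub>1 + \<gamma> c\<^sub>n = 0\<close>. Caputo differentiation of order \<open>m\<nu>\<close> shifts the coefficients by
  \<open>m\<close> (\<open>fractional_power_series_caputo\<close>; \<open>c\<^sub>1 = 0\<close> is what makes this true for \<open>m = 2\<close>), so the
  recurrence is the fractional differential equation. Its characteristic roots are \<open>r\<^sub>1, r\<^sub>2\<close>: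
  solving it by powers of distinct roots gives the formula with two one-variable Mittag-Leffler
  functions, solving it by complete homogeneous polynomials \<open>\<Sum> r\<^sub>1\<^bsup>i\<^esup> r\<^sub>2\<^bsup>n-i\<^esup>\<close> gives the two-variable
  one, which stays valid when the roots coincide.

  Finally \<open>E u\<^bsup>M(s)\<^esup> = exp (- c s)\<close> with \<open>c = \<Sum> \<lambda>\<^sub>j (1 - u\<^sup>j)\<close>, because this function of \<open>s\<close> is
  multiplicative with right derivative \<open>- c\<close> at \<open>0\<close>; conditioning on the independent time \<open>L(t)\<close>
  turns it into \<open>\<ell>(c, t)\<close>. As \<open>M\<close> is only known to be right-continuous in time, the conditioning is
  done for discretised times decreasing to \<open>L(t)\<close> (\<open>counting_process_subordination\<close>).
\<close>

section \<open>Series with Gamma denominators\<close>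

text \<open>
  In Euler's integral keep only \<open>t \<ge> a\<close> and bound \<open>t powr y\<close> below by \<open>a powr y\<close>. As \<open>a\<close> is free,
  the Gamma function outgrows every exponential, without any appeal to Stirling's formula.
\<close>
lemma Gamma_ge_powr_times_exp:
  fixes a y :: real
  assumes "0 < a" "0 \<le> y"
  shows "a powr y * exp (- a) \<le> Gamma (y + 1)"
proof -
  have f: "((\<lambda>t. t powr y / exp t) has_integral Gamma (y + 1)) {0..}"
    using Gamma_integral_real[of "y + 1"] assms by simp
  have "((\<lambda>t. exp (- 1 * t)) has_integral exp (- 1 * a) / 1) {a..}"
    by (rule has_integral_exp_minus_to_infinity) simp
  from has_integral_mult_right[OF this, of "a powr y"]
  have g: "((\<lambda>t. a powr y * exp (- t)) has_integral a powr y * exp (- a)) {a..}"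
    by simp
  have "((\<lambda>t. if t \<in> {a..} then a powr y * exp (- t) else 0) has_integral
      a powr y * exp (- a)) {0..}"
    using g assms by (subst has_integral_restrict) auto
  then show ?thesis
  proof (rule has_integral_le[OF _ f])
    fix t :: real
    assume "t \<in> {0..}"
    then show "(if t \<in> {a..} then a powr y * exp (- t) else 0) \<le> t powr y / exp t"
      using assms by (auto simp: exp_minus field_simps intro!: powr_mono2)
  qed
qed

text \<open>
  The number \<open>a\<close> is chosen so that \<open>a powr (\<nu> * n) = (2 * (R + 1)) ^ n\<close>, which beats \<open>R ^ n\<close>
  by a factor \<open>2 ^ n\<close>.
\<close>
lemma summable_power_over_Gamma:
  fixes \<nu> R :: real
  assumes "0 < \<nu>" "0 \<le> R"
  shows "summable (\<lambda>n. R ^ n / Gamma (\<nu> * real n + 1))"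
proof (rule summable_comparison_test')
  define a where "a = (2 * (R + 1)) powr (1 / \<nu>)"
  have a: "0 < a" using assms by (simp add: a_def)
  show "summable (\<lambda>n. exp a * (1 / 2) ^ n)"
    by (intro summable_mult summable_geometric) auto
  fix n :: nat
  have "a powr (\<nu> * real n) = (2 * (R + 1)) ^ n"
    using assms by (simp add: a_def powr_powr powr_realpow)
  then have G: "(2 * (R + 1)) ^ n * exp (- a) \<le> Gamma (\<nu> * real n + 1)"
    using Gamma_ge_powr_times_exp[OF a, of "\<nu> * real n"] assms by simp
  have pos: "0 < (2 * (R + 1)) ^ n * exp (- a)" using assms by simp
  have "R ^ n / Gamma (\<nu> * real n + 1) \<le> (R + 1) ^ n / ((2 * (R + 1)) ^ n * exp (- a))"
    using G pos assms by (intro frac_le power_mono) auto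
  also have "\<dots> = exp a * (1 / 2) ^ n"
    using assms by (simp add: power_mult_distrib exp_minus divide_simps del: distrib_left_numeral)
  finally have "R ^ n / Gamma (\<nu> * real n + 1) \<le> exp a * (1 / 2) ^ n" .
  moreover have "0 \<le> R ^ n / Gamma (\<nu> * real n + 1)"
    using order_trans[OF less_imp_le[OF pos] G] assms by (intro divide_nonneg_nonneg) auto
  ultimately show "norm (R ^ n / Gamma (\<nu> * real n + 1)) \<le> exp a * (1 / 2) ^ n"
    by simp
qed

lemma summable_coeff_over_Gamma:
  fixes c :: "nat \<Rightarrow> 'b :: real_normed_field"
  assumes "0 < \<nu>" and "0 \<le> R" and c: "\<And>n. norm (c n) \<le> R ^ n"
  shows "summable (\<lambda>n. norm (c n * x ^ n / of_real (Gamma (\<nu> * real n + 1))))"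
proof (rule summable_comparison_test')
  show "summable (\<lambda>n. (R * norm x) ^ n / Gamma (\<nu> * real n + 1))"
    by (intro summable_power_over_Gamma assms mult_nonneg_nonneg norm_ge_zero)
  fix n :: nat
  have "0 < Gamma (\<nu> * real n + 1)"
    using assms(1) by (intro Gamma_real_pos) (simp add: add_nonneg_pos)
  then show "norm (norm (c n * x ^ n / of_real (Gamma (\<nu> * real n + 1))))
      \<le> (R * norm x) ^ n / Gamma (\<nu> * real n + 1)"
    using c[of n] by (simp add: norm_mult norm_divide norm_power power_mult_distrib
        divide_right_mono mult_right_mono)
qed

text \<open>
  The iterated sum is absolutely convergent over all pairs, hence may be summed along the diagonals
  \<open>k1 + k2 = n\<close>. A diagonal has \<open>n + 1 \<le> 2 ^ n\<close> terms, which explains the factor \<open>2\<close> in the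
  hypothesis.
\<close>
lemma suminf_double_diagonal:
  fixes a :: "nat \<Rightarrow> complex"
  assumes R: "norm z1 \<le> R" "norm z2 \<le> R"
    and a: "summable (\<lambda>n. norm (a n) * (2 * R) ^ n)"
  shows "(\<Sum>k1. \<Sum>k2. a (k1 + k2) * z1 ^ k1 * z2 ^ k2) = (\<Sum>n. a n * (\<Sum>i\<le>n. z1 ^ i * z2 ^ (n - i)))"
    and "summable (\<lambda>n. a n * (\<Sum>i\<le>n. z1 ^ i * z2 ^ (n - i)))"
proof -
  define f where "f = (\<lambda>(n, i). a n * (z1 ^ i * z2 ^ (n - i)))"
  define g where "g = (\<lambda>(k1, k2). a (k1 + k2) * z1 ^ k1 * z2 ^ k2)"
  have "0 \<le> R" using R norm_ge_zero order_trans by blast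
  have bound: "(\<Sum>i\<le>n. norm (f (n, i))) \<le> norm (a n) * (2 * R) ^ n" for n
  proof -
    have "norm (f (n, i)) \<le> norm (a n) * R ^ n" if "i \<le> n" for i
    proof -
      have "norm (z1 ^ i * z2 ^ (n - i)) \<le> R ^ i * R ^ (n - i)"
        unfolding norm_mult norm_power using R \<open>0 \<le> R\<close>
        by (intro mult_mono power_mono) auto
      also have "\<dots> = R ^ n" using that by (simp flip: power_add)
      finally show ?thesis by (simp add: f_def norm_mult mult_left_mono)
    qed
    then have "(\<Sum>i\<le>n. norm (f (n, i))) \<le> (\<Sum>i\<le>n. norm (a n) * R ^ n)"
      by (intro sum_mono) auto
    also have "\<dots> = real (n + 1) * (norm (a n) * R ^ n)" by simp
    also have "real (n + 1) \<le> 2 ^ n"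
      using of_nat_mono[of "n + 1" "2 ^ n"] by (simp add: Suc_leI)
    then have "real (n + 1) * (norm (a n) * R ^ n) \<le> 2 ^ n * (norm (a n) * R ^ n)"
      using \<open>0 \<le> R\<close> by (intro mult_right_mono) auto
    finally show ?thesis by (simp add: power_mult_distrib mult_ac)
  qed
  have f_abs: "(\<lambda>p. norm (f p)) summable_on (SIGMA n:UNIV. {..n})"
    unfolding Infinite_Sum.abs_summable_on_Sigma_iff
  proof (intro conjI ballI)
    fix n :: nat
    show "(\<lambda>i. norm (f (n, i))) summable_on {..n}" by simp
  next
    have "summable (\<lambda>n. norm (\<Sum>i\<le>n. norm (f (n, i))))"
      using bound by (intro summable_comparison_test'[OF a]) (auto simp: sum_nonneg)
    then show "(\<lambda>n. norm (\<Sum>\<^sub>\<infinity>i\<in>{..n}. norm (f (n, i)))) summable_on UNIV"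
      by (simp add: summable_on_UNIV_nonneg_real_iff)
  qed
  then have f: "f summable_on (SIGMA n:UNIV. {..n})"
    by (rule abs_summable_summable)
  have bij: "bij_betw (\<lambda>(k1, k2). (k1 + k2, k1)) (UNIV \<times> UNIV) (SIGMA n:UNIV. {..n::nat})"
    by (rule bij_betwI[where g = "\<lambda>(n, i). (i, n - i)"]) auto
  have fg: "f (case p of (k1, k2) \<Rightarrow> (k1 + k2, k1)) = g p" for p
    by (cases p) (simp add: f_def g_def)
  have g: "g summable_on (UNIV \<times> UNIV)"
    using summable_on_reindex_bij_betw[OF bij, of f] f by (simp add: fg)
  have eq: "infsum g (UNIV \<times> UNIV) = infsum f (SIGMA n:UNIV. {..n})"
    using infsum_reindex_bij_betw[OF bij, of f] by (simp add: fg)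
  have suminf_eq: "suminf h = infsum h UNIV" if "h summable_on UNIV" for h :: "nat \<Rightarrow> complex"
    using has_sum_imp_sums[OF has_sum_infsum[OF that]] by (simp add: sums_iff)
  have inner: "(\<lambda>k2. g (k1, k2)) summable_on UNIV" for k1
    using summable_on_SigmaD1[where f = "\<lambda>x y. g (x, y)" and A = UNIV and B = "\<lambda>_. UNIV"] g
    by simp
  have outer: "(\<lambda>k1. \<Sum>\<^sub>\<infinity>k2. g (k1, k2)) summable_on UNIV"
    using summable_on_Sigma_banach[of "\<lambda>x y. g (x, y)" UNIV "\<lambda>_. UNIV"] g by simp
  have finner: "(\<Sum>\<^sub>\<infinity>i\<in>{..n}. f (n, i)) = a n * (\<Sum>i\<le>n. z1 ^ i * z2 ^ (n - i))" for n
    by (simp add: f_def sum_distrib_left)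
  have fouter: "(\<lambda>n. \<Sum>\<^sub>\<infinity>i\<in>{..n}. f (n, i)) summable_on UNIV"
    using summable_on_Sigma_banach[of "\<lambda>x y. f (x, y)" UNIV "\<lambda>n. {..n}"] f by simp
  show "summable (\<lambda>n. a n * (\<Sum>i\<le>n. z1 ^ i * z2 ^ (n - i)))"
    using summable_on_imp_summable[OF fouter] by (simp only: finner)
  have "(\<Sum>k1. \<Sum>k2. a (k1 + k2) * z1 ^ k1 * z2 ^ k2) = (\<Sum>k1. \<Sum>\<^sub>\<infinity>k2. g (k1, k2))"
    using suminf_eq[OF inner] by (simp add: g_def)
  also have "\<dots> = infsum g (UNIV \<times> UNIV)"
    using suminf_eq[OF outer] infsum_Sigma_banach[OF g] by simp
  also have "\<dots> = (\<Sum>\<^sub>\<infinity>n. \<Sum>\<^sub>\<infinity>i\<in>{..n}. f (n, i))"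
    using infsum_Sigma_banach[OF f] eq by simp
  also have "\<dots> = (\<Sum>n. a n * (\<Sum>i\<le>n. z1 ^ i * z2 ^ (n - i)))"
    using suminf_eq[OF fouter] by (simp only: finner)
  finally show "(\<Sum>k1. \<Sum>k2. a (k1 + k2) * z1 ^ k1 * z2 ^ k2)
      = (\<Sum>n. a n * (\<Sum>i\<le>n. z1 ^ i * z2 ^ (n - i)))" .
qed

text \<open>
  Up to the factor \<open>R\<close> the series for the parameter \<open>\<nu> + 1\<close> is the one for \<open>1\<close> with its index moved by one.
\<close>
lemma summable_power_over_Gamma_shift:
  fixes \<nu> R :: real
  assumes "0 < \<nu>" "0 < R"
  shows "summable (\<lambda>n. R ^ n / Gamma (\<nu> * real n + (\<nu> + 1)))"
proof -
  have "summable (\<lambda>n. R ^ Suc n / Gamma (\<nu> * real (Suc n) + 1))"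
    using summable_power_over_Gamma[of \<nu> R] assms summable_Suc_iff[of "\<lambda>n. R ^ n / Gamma (\<nu> * real n + 1)"] by simp
  from summable_mult[OF this, of "1 / R"] show ?thesis
    using assms by (simp add: algebra_simps)
qed

lemma mittag_leffler_sums:
  assumes "0 < \<nu>"
  shows "(\<lambda>n. r ^ n * x ^ n / of_real (Gamma (\<nu> * real n + 1))) sums mittag_leffler \<nu> 1 (r * x)"
proof -
  have "summable (\<lambda>n. norm (r ^ n * x ^ n / of_real (Gamma (\<nu> * real n + 1))))"
    by (rule summable_coeff_over_Gamma[OF assms norm_ge_zero[of r]]) (simp add: norm_power)
  then have "summable (\<lambda>n. r ^ n * x ^ n / of_real (Gamma (\<nu> * real n + 1)))"
    by (rule summable_norm_cancel)
  then show ?thesis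
    by (simp add: mittag_leffler_def sums_iff power_mult_distrib Gamma_complex_of_real[symmetric])
qed

text \<open>
  When both upper parameters are \<open>1\<close> the Pochhammer symbols cancel the factorials, and the terms
  depend on the indices only through their sum and the two powers.
\<close>
lemma mittag_leffler2_sums:
  assumes summable: "\<And>R. 0 < R \<Longrightarrow> summable (\<lambda>n. R ^ n / Gamma (\<nu> * real n + b))"
    and \<nu>: "0 < \<nu>" and b: "0 < b"
  shows "(\<lambda>n. (\<Sum>i\<le>n. r1 ^ i * r2 ^ (n - i)) * x ^ n / of_real (Gamma (\<nu> * real n + b)))
    sums mittag_leffler2 \<nu> b 1 1 (r1 * x) (r2 * x)"
proof -
  define a where "a = (\<lambda>n. 1 / complex_of_real (Gamma (\<nu> * real n + b)))"
  define R where "R = norm (r1 * x) + norm (r2 * x) + 1"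
  have R: "norm (r1 * x) \<le> R" "norm (r2 * x) \<le> R" "0 < R"
    by (auto simp: R_def intro: add_nonneg_pos)
  have "0 < Gamma (\<nu> * real n + b)" for n
    using \<nu> b by (intro Gamma_real_pos) (simp add: add_nonneg_pos)
  then have a: "summable (\<lambda>n. norm (a n) * (2 * R) ^ n)"
    using summable[of "2 * R"] R by (simp add: a_def norm_divide abs_of_pos)
  have inner: "a n * (\<Sum>i\<le>n. (r1 * x) ^ i * (r2 * x) ^ (n - i)) =
      (\<Sum>i\<le>n. r1 ^ i * r2 ^ (n - i)) * x ^ n / of_real (Gamma (\<nu> * real n + b))" for n
  proof -
    have "(r1 * x) ^ i * (r2 * x) ^ (n - i) = r1 ^ i * r2 ^ (n - i) * x ^ n" if "i \<le> n" for i
    proof -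
      have "x ^ n = x ^ i * x ^ (n - i)" using that by (simp flip: power_add)
      then show ?thesis by (simp add: power_mult_distrib mult_ac)
    qed
    then show ?thesis by (simp add: a_def sum_distrib_right)
  qed
  have "mittag_leffler2 \<nu> b 1 1 (r1 * x) (r2 * x) =
      (\<Sum>k1. \<Sum>k2. a (k1 + k2) * (r1 * x) ^ k1 * (r2 * x) ^ k2)"
    unfolding mittag_leffler2_def a_def Gamma_complex_of_real by (simp flip: pochhammer_fact)
  then show ?thesis
    using suminf_double_diagonal[OF R(1,2) a] by (simp add: sums_iff inner)
qed

section \<open>Power series in a fractional power of time\<close>

text \<open>
  The normalisation by \<open>\<Gamma>(\<nu>n + 1)\<close> makes both the Laplace transform and Caputo differentiation
  act on the coefficients alone.
\<close>
definition fractional_power_series :: "real \<Rightarrow> (nat \<Rightarrow> real) \<Rightarrow> real \<Rightarrow> real" where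
  "fractional_power_series \<nu> c t = (\<Sum>n. c n * (t powr \<nu>) ^ n / Gamma (\<nu> * real n + 1))"

lemma fractional_power_series_0:
  assumes "0 < \<nu>"
  shows "fractional_power_series \<nu> c 0 = c 0"
  using assms powser_zero[of "\<lambda>n. c n / Gamma (\<nu> * real n + 1)"]
  by (simp add: fractional_power_series_def)

text \<open>
  This integral computes the Caputo derivative of a single power.
\<close>
lemma has_bochner_integral_Beta_scaled:
  fixes a b t :: real
  assumes "0 < a" "0 < b" "0 < t"
  shows "has_bochner_integral lborel
    (\<lambda>s. indicator {0<..<t} s * (s powr (a - 1) * (t - s) powr (b - 1))) (t powr (a + b - 1) * Beta a b)"
proof -
  let ?f = "\<lambda>s. indicator {0<..<1} s * (s powr (a - 1) * (1 - s) powr (b - 1))"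
  have "((\<lambda>s. s powr (a - 1) * (1 - s) powr (b - 1)) has_integral Beta a b) {0<..<1}"
    using has_integral_Beta_real[OF assms(1,2)] by (simp add: has_integral_Icc_iff_Ioo)
  then have "(\<integral>\<^sup>+s. ennreal (s powr (a - 1) * (1 - s) powr (b - 1)) * indicator {0<..<1} s \<partial>lborel)
      = ennreal (Beta a b)"
    by (intro nn_integral_has_integral_lebesgue') auto
  also have "(\<integral>\<^sup>+s. ennreal (s powr (a - 1) * (1 - s) powr (b - 1)) * indicator {0<..<1} s \<partial>lborel)
      = (\<integral>\<^sup>+s. ennreal (?f s) \<partial>lborel)"
    by (intro nn_integral_cong) (auto split: split_indicator)
  finally have "has_bochner_integral lborel ?f (Beta a b)"
    using assms by (intro has_bochner_integral_nn_integral) (auto simp: Beta_def intro!: divide_nonneg_nonneg mult_nonneg_nonneg less_imp_le[OF Gamma_real_pos])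
  then have "has_bochner_integral lborel (\<lambda>s. t powr (a + b - 2) * ?f s) (t powr (a + b - 2) * Beta a b)"
    by (rule has_bochner_integral_mult_right)
  also have "(\<lambda>s. t powr (a + b - 2) * ?f s) =
      (\<lambda>s. indicator {0<..<t} (0 + t * s) * ((0 + t * s) powr (a - 1) * (t - (0 + t * s)) powr (b - 1)))"
  proof
    fix s :: real
    have "t powr (a + b - 2) = t powr (a - 1) * t powr (b - 1)"
      by (simp flip: powr_add add: algebra_simps)
    moreover have "t - t * s = t * (1 - s)" by (simp add: algebra_simps)
    ultimately show "t powr (a + b - 2) * ?f s =
      indicator {0<..<t} (0 + t * s) * ((0 + t * s) powr (a - 1) * (t - (0 + t * s)) powr (b - 1))"
      using assms by (auto simp: powr_mult zero_less_mult_iff split: split_indicator)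
  qed
  also have "t powr (a + b - 2) * Beta a b = (t powr (a + b - 1) * Beta a b) /\<^sub>R \<bar>t\<bar>"
    using assms powr_add[of t "a + b - 2" 1] by (simp add: field_simps)
  finally show ?thesis
    using assms by (subst lborel_has_bochner_integral_real_affine_iff[of t _ _ 0]) auto
qed

lemma has_bochner_integral_Gamma_scaled:
  fixes y s :: real
  assumes "0 \<le> y" "0 < s"
  shows "has_bochner_integral lborel
    (\<lambda>t. indicator {0<..} t * (t powr y * exp (- (s * t)))) (Gamma (y + 1) / s powr (y + 1))"
proof -
  let ?f = "\<lambda>t. indicator {0<..} t * (t powr y * exp (- t))"
  have "((\<lambda>t. t powr y / exp t) has_integral Gamma (y + 1)) {0..}"
    using Gamma_integral_real[of "y + 1"] assms by simp
  then have "(\<integral>\<^sup>+t. ennreal (t powr y / exp t) * indicator {0..} t \<partial>lborel) = ennreal (Gamma (y + 1))"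
    by (intro nn_integral_has_integral_lebesgue') auto
  also have "(\<integral>\<^sup>+t. ennreal (t powr y / exp t) * indicator {0..} t \<partial>lborel) = (\<integral>\<^sup>+t. ennreal (?f t) \<partial>lborel)"
  proof (rule nn_integral_cong)
    fix t :: real
    show "ennreal (t powr y / exp t) * indicator {0..} t = ennreal (?f t)"
      by (cases "t = 0") (auto simp: exp_minus divide_inverse split: split_indicator)
  qed
  finally have "has_bochner_integral lborel ?f (Gamma (y + 1))"
    using assms by (intro has_bochner_integral_nn_integral) (auto intro!: less_imp_le[OF Gamma_real_pos])
  then have "has_bochner_integral lborel (\<lambda>t. ?f (0 + s * t)) (Gamma (y + 1) /\<^sub>R \<bar>s\<bar>)"
    using assms by (subst (asm) lborel_has_bochner_integral_real_affine_iff[of s _ _ 0]) auto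
  from has_bochner_integral_mult_right[OF this, of "1 / s powr y"]
  have "has_bochner_integral lborel (\<lambda>t. 1 / s powr y * ?f (0 + s * t))
      (1 / s powr y * (Gamma (y + 1) /\<^sub>R \<bar>s\<bar>))"
    by simp
  also have "(\<lambda>t. 1 / s powr y * ?f (0 + s * t)) =
      (\<lambda>t. indicator {0<..} t * (t powr y * exp (- (s * t))))"
    using assms by (auto simp: fun_eq_iff powr_mult zero_less_mult_iff split: split_indicator)
  also have "1 / s powr y * (Gamma (y + 1) /\<^sub>R \<bar>s\<bar>) = Gamma (y + 1) / s powr (y + 1)"
    using assms by (simp add: powr_add field_simps)
  finally show ?thesis .
qed

context
  fixes \<nu> R :: real and c :: "nat \<Rightarrow> real"
  assumes \<nu>: "0 < \<nu>" and R: "0 \<le> R" and c: "\<And>n. \<bar>c n\<bar> \<le> R ^ n"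
begin

lemma fractional_power_series_summable:
  "summable (\<lambda>n. \<bar>c n\<bar> * x ^ n / Gamma (\<nu> * real n + 1))"
  using summable_coeff_over_Gamma[of \<nu> R "\<lambda>n. \<bar>c n\<bar>" x] \<nu> R c
  by (auto intro: summable_norm_cancel)

lemma fractional_power_series_shift_summable:
  assumes "0 \<le> x"
  shows "summable (\<lambda>n. \<bar>c (n + m)\<bar> * x ^ n / Gamma (\<nu> * real n + 1))"
proof (rule summable_comparison_test')
  show "summable (\<lambda>n. R ^ m * ((R * x) ^ n / Gamma (\<nu> * real n + 1)))"
    using summable_power_over_Gamma[OF \<nu>, of "R * x"] R assms by (intro summable_mult) auto
  fix n :: nat
  have "0 < Gamma (\<nu> * real n + 1)"
    using \<nu> by (intro Gamma_real_pos) (simp add: add_nonneg_pos)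
  moreover have "\<bar>c (n + m)\<bar> * x ^ n \<le> R ^ (n + m) * x ^ n"
    using c[of "n + m"] assms by (intro mult_right_mono) auto
  ultimately show "norm (\<bar>c (n + m)\<bar> * x ^ n / Gamma (\<nu> * real n + 1))
      \<le> R ^ m * ((R * x) ^ n / Gamma (\<nu> * real n + 1))"
    using assms by (simp add: abs_mult divide_right_mono power_add power_mult_distrib mult_ac)
qed

lemma fractional_power_series_has_deriv:
  assumes "0 < s"
  shows "(fractional_power_series \<nu> c has_real_derivative
      (\<Sum>n. c (Suc n) / Gamma (\<nu> * real (Suc n)) * s powr (\<nu> * real (Suc n) - 1))) (at s)"
    and "summable (\<lambda>n. \<bar>c (Suc n)\<bar> / Gamma (\<nu> * real (Suc n)) * s powr (\<nu> * real (Suc n) - 1))"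
proof -
  define d where "d = (\<lambda>n. c n / Gamma (\<nu> * real n + 1))"
  have d_abs: "summable (\<lambda>n. \<bar>d n\<bar> * x ^ n)" for x
  proof -
    have "\<bar>d n\<bar> = \<bar>c n\<bar> / Gamma (\<nu> * real n + 1)" for n
    proof -
      have "0 < Gamma (\<nu> * real n + 1)"
        using \<nu> by (intro Gamma_real_pos) (simp add: add_nonneg_pos)
      then show ?thesis by (simp add: d_def)
    qed
    then show ?thesis using fractional_power_series_summable[of x] by simp
  qed
  have d: "summable (\<lambda>n. d n * x ^ n)" for x
    by (rule summable_rabs_cancel, rule summable_comparison_test'[OF d_abs[of "\<bar>x\<bar>"]])
      (simp add: abs_mult power_abs)
  have term_eq: "diffs e n * (s powr \<nu>) ^ n * (\<nu> * s powr (\<nu> - 1)) =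
      b (Suc n) / Gamma (\<nu> * real (Suc n)) * s powr (\<nu> * real (Suc n) - 1)"
    if "\<And>n. e n = b n / Gamma (\<nu> * real n + 1)" for e b n
  proof -
    have "Gamma (\<nu> * real (Suc n) + 1) = \<nu> * real (Suc n) * Gamma (\<nu> * real (Suc n))"
      using \<nu> nonpos_Ints_nonpos[of "\<nu> * real (Suc n)"] by (intro Gamma_plus1) (auto simp: mult_le_0_iff)
    moreover have "(s powr \<nu>) ^ n * s powr (\<nu> - 1) = s powr (\<nu> * real (Suc n) - 1)"
      using assms \<nu> by (simp add: powr_power algebra_simps flip: powr_add)
    ultimately show ?thesis
      using \<nu> Gamma_real_pos[of "\<nu> * real (Suc n)"]
      by (simp add: diffs_def that field_simps del: of_nat_Suc)
  qed
  have "((\<lambda>x. \<Sum>n. d n * x ^ n) has_real_derivative (\<Sum>n. diffs d n * (s powr \<nu>) ^ n)) (at (s powr \<nu>))"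
    by (intro termdiffs_strong_converges_everywhere d)
  moreover have "((\<lambda>t. t powr \<nu>) has_real_derivative \<nu> * s powr (\<nu> - 1)) (at s)"
    by (rule has_real_derivative_powr) (rule assms)
  ultimately have "((\<lambda>t. \<Sum>n. d n * (t powr \<nu>) ^ n) has_real_derivative
      (\<Sum>n. diffs d n * (s powr \<nu>) ^ n) * (\<nu> * s powr (\<nu> - 1))) (at s)"
    by (rule DERIV_chain2)
  moreover have "(\<lambda>t. \<Sum>n. d n * (t powr \<nu>) ^ n) = fractional_power_series \<nu> c"
    by (simp add: fractional_power_series_def d_def fun_eq_iff)
  moreover have "(\<Sum>n. diffs d n * (s powr \<nu>) ^ n) * (\<nu> * s powr (\<nu> - 1)) =
      (\<Sum>n. c (Suc n) / Gamma (\<nu> * real (Suc n)) * s powr (\<nu> * real (Suc n) - 1))"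
    by (subst suminf_mult2[OF termdiff_converges_all[OF d]]) (simp only: term_eq d_def)
  ultimately show "(fractional_power_series \<nu> c has_real_derivative
      (\<Sum>n. c (Suc n) / Gamma (\<nu> * real (Suc n)) * s powr (\<nu> * real (Suc n) - 1))) (at s)"
    by simp
  have "summable (\<lambda>n. \<bar>c n\<bar> / Gamma (\<nu> * real n + 1) * x ^ n)" for x
    using fractional_power_series_summable[of x] by simp
  from summable_mult2[OF termdiff_converges_all[OF this, of "s powr \<nu>"], of "\<nu> * s powr (\<nu> - 1)"]
  show "summable (\<lambda>n. \<bar>c (Suc n)\<bar> / Gamma (\<nu> * real (Suc n)) * s powr (\<nu> * real (Suc n) - 1))"
    by (simp only: term_eq)
qed

lemma fractional_power_series_continuous_on: "continuous_on {0..} (fractional_power_series \<nu> c)"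
proof -
  have "summable (\<lambda>n. c n / Gamma (\<nu> * real n + 1) * x ^ n)" for x
  proof -
    have "summable (\<lambda>n. norm (c n * x ^ n / of_real (Gamma (\<nu> * real n + 1))))"
      using c by (intro summable_coeff_over_Gamma[OF \<nu> R]) auto
    from summable_norm_cancel[OF this] show ?thesis by simp
  qed
  then have "isCont (\<lambda>x. \<Sum>n. c n / Gamma (\<nu> * real n + 1) * x ^ n) x" for x
    by (rule isCont_powser_converges_everywhere)
  then have "continuous_on UNIV (\<lambda>x. \<Sum>n. c n / Gamma (\<nu> * real n + 1) * x ^ n)"
    by (intro continuous_at_imp_continuous_on) auto
  moreover have "continuous_on {0..} (\<lambda>t. t powr \<nu>)"
    using \<nu> by (intro continuous_on_powr') (auto intro: continuous_intros)
  ultimately show ?thesis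
    unfolding fractional_power_series_def[abs_def]
    using continuous_on_compose2[of UNIV "\<lambda>x. \<Sum>n. c n / Gamma (\<nu> * real n + 1) * x ^ n"] by fastforce
qed

text \<open>
  Term by term, Euler's Beta integral sends \<open>t\<^bsup>\<nu>n\<^esup> / \<Gamma>(\<nu>n + 1)\<close> to \<open>t\<^bsup>\<nu>(n-m)\<^esup> / \<Gamma>(\<nu>(n-m) + 1)\<close>.
  The powers with \<open>0 < n < m\<close> must be absent, since they would be sent to negative powers of \<open>t\<close>.
  The hypothesis on \<open>f\<close> concerns nonnegative times only, because the functions to which this is
  applied come from processes indexed by \<open>t \<ge> 0\<close>.
\<close>
lemma fractional_power_series_caputo:
  fixes m :: nat and f :: "real \<Rightarrow> real"
  assumes m: "0 < m" "\<nu> * real m \<le> 1" and c_zero: "\<And>n. 0 < n \<Longrightarrow> n < m \<Longrightarrow> c n = 0"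
    and f: "\<And>t. 0 \<le> t \<Longrightarrow> f t = fractional_power_series \<nu> c t" and t: "0 < t"
  shows "caputo_differentiable (\<nu> * real m) f t"
    and "caputo_deriv (\<nu> * real m) f t = fractional_power_series \<nu> (\<lambda>n. c (n + m)) t"
proof -
  define \<beta> where "\<beta> = \<nu> * real m"
  have \<beta>: "0 < \<beta>" "\<beta> \<le> 1" using m \<nu> by (auto simp: \<beta>_def)
  have f_deriv: "(f has_real_derivative
      (\<Sum>n. c (Suc n) / Gamma (\<nu> * real (Suc n)) * s powr (\<nu> * real (Suc n) - 1))) (at s)" if "0 < s" for s
    by (rule has_field_derivative_transform_within_open
        [OF fractional_power_series_has_deriv(1)[OF that], of "{0<..}"])
      (use that f in auto)
  define e where "e = (\<lambda>n s. c (n + m) / Gamma (\<nu> * real n + \<beta>) * s powr (\<nu> * real n + \<beta> - 1))"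
  have shift: "Suc (n + (m - 1)) = n + m" "\<nu> * real (n + m) = \<nu> * real n + \<beta>" for n
    using m by (auto simp: \<beta>_def algebra_simps)
  have deriv: "deriv f s = (\<Sum>n. e n s)" and e_abs: "summable (\<lambda>n. \<bar>e n s\<bar>)" if "0 < s" for s
  proof -
    let ?g = "\<lambda>n. c (Suc n) / Gamma (\<nu> * real (Suc n)) * s powr (\<nu> * real (Suc n) - 1)"
    have G: "0 < Gamma (\<nu> * real (Suc n))" for n using \<nu> by (intro Gamma_real_pos) auto
    have "summable (\<lambda>n. \<bar>?g n\<bar>)"
      using fractional_power_series_has_deriv(2)[OF that] G
      by (simp add: abs_mult less_imp_le del: of_nat_Suc)
    then have "summable ?g" "summable (\<lambda>n. \<bar>?g (n + (m - 1))\<bar>)"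
      by (rule summable_rabs_cancel, rule summable_ignore_initial_segment)
    have g_e: "?g (n + (m - 1)) = e n s" for n
      by (simp only: shift e_def)
    show "summable (\<lambda>n. \<bar>e n s\<bar>)"
      using \<open>summable (\<lambda>n. \<bar>?g (n + (m - 1))\<bar>)\<close> by (simp only: g_e)
    have "(\<Sum>n. ?g n) = (\<Sum>n. ?g (n + (m - 1))) + (\<Sum>i<m - 1. ?g i)"
      by (rule suminf_split_initial_segment) fact
    also have "(\<Sum>i<m - 1. ?g i) = 0"
      using c_zero by (intro sum.neutral) auto
    finally show "deriv f s = (\<Sum>n. e n s)"
      using DERIV_imp_deriv[OF f_deriv[OF that]] by (simp only: g_e add_0_right)
  qed
  have f_diff: "f differentiable (at s)" if "0 < s" for s
    using f_deriv[OF that] real_differentiable_def by blast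
  have f_cont: "continuous_on {0..t} f"
    using continuous_on_subset[OF fractional_power_series_continuous_on, of "{0..t}"]
    by (subst continuous_on_cong[OF refl f]) auto
  have main: "(\<beta> \<noteq> 1 \<longrightarrow> set_integrable lborel {0<..<t} (\<lambda>s. deriv f s / (t - s) powr \<beta>)) \<and>
      caputo_deriv \<beta> f t = fractional_power_series \<nu> (\<lambda>n. c (n + m)) t"
  proof (cases "\<beta> = 1")
    case True
    then have "deriv f t = (\<Sum>n. c (n + m) * (t powr \<nu>) ^ n / Gamma (\<nu> * real n + 1))"
      using t by (simp add: deriv e_def powr_power mult.commute)
    with True show ?thesis by (simp add: caputo_deriv_def fractional_power_series_def)
  next
    case False
    with \<beta> have \<beta>1: "\<beta> < 1" by simp
    define b where "b = (\<lambda>n s. indicator {0<..<t} s * (s powr (\<nu> * real n + \<beta> - 1) * (t - s) powr (1 - \<beta> - 1)))"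
    define g where "g = (\<lambda>n. t powr (\<nu> * real n) * (Gamma (\<nu> * real n + \<beta>) * Gamma (1 - \<beta>) / Gamma (\<nu> * real n + 1)))"
    have G: "0 < Gamma (\<nu> * real n + \<beta>)" for n
      using \<nu> \<beta> by (intro Gamma_real_pos) (auto intro: add_nonneg_pos)
    have b: "has_bochner_integral lborel (b n) (g n)" for n
      using has_bochner_integral_Beta_scaled[of "\<nu> * real n + \<beta>" "1 - \<beta>" t] \<nu> \<beta> \<beta>1 t
      by (simp add: b_def g_def Beta_def add_nonneg_pos)
    define h where "h = (\<lambda>n s. c (n + m) / Gamma (\<nu> * real n + \<beta>) * b n s)"
    have h: "has_bochner_integral lborel (h n) (c (n + m) / Gamma (\<nu> * real n + \<beta>) * g n)" for n
      unfolding h_def by (intro has_bochner_integral_mult_right b)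
    have h_eq: "h n s = indicator {0<..<t} s * (e n s / (t - s) powr \<beta>)" for n s
      by (auto simp: h_def b_def e_def powr_minus_divide split: split_indicator)
    have int_h: "c (n + m) / Gamma (\<nu> * real n + \<beta>) * g n =
        Gamma (1 - \<beta>) * (c (n + m) * (t powr \<nu>) ^ n / Gamma (\<nu> * real n + 1))" for n
      using G[of n] t by (simp add: g_def powr_power mult_ac)
    have b_nonneg: "0 \<le> b n s" for n s by (simp add: b_def)
    have h_abs: "has_bochner_integral lborel (\<lambda>s. norm (h n s))
        (Gamma (1 - \<beta>) * (\<bar>c (n + m)\<bar> * (t powr \<nu>) ^ n / Gamma (\<nu> * real n + 1)))" for n
    proof -
      have "has_bochner_integral lborel (\<lambda>s. \<bar>c (n + m)\<bar> / Gamma (\<nu> * real n + \<beta>) * b n s)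
         (\<bar>c (n + m)\<bar> / Gamma (\<nu> * real n + \<beta>) * g n)"
        by (intro has_bochner_integral_mult_right b)
      moreover have "(\<lambda>s. norm (h n s)) = (\<lambda>s. \<bar>c (n + m)\<bar> / Gamma (\<nu> * real n + \<beta>) * b n s)"
        using G[of n] b_nonneg[of n] by (simp add: h_def abs_mult fun_eq_iff)
      moreover have "\<bar>c (n + m)\<bar> / Gamma (\<nu> * real n + \<beta>) * g n =
         Gamma (1 - \<beta>) * (\<bar>c (n + m)\<bar> * (t powr \<nu>) ^ n / Gamma (\<nu> * real n + 1))"
        using G[of n] t by (simp add: g_def powr_power mult_ac)
      ultimately show ?thesis by simp
    qed
    have sum: "summable (\<lambda>n. \<bar>c (n + m)\<bar> * (t powr \<nu>) ^ n / Gamma (\<nu> * real n + 1))"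
      by (rule fractional_power_series_shift_summable) simp
    have h_summable: "summable (\<lambda>n. norm (h n s))" for s
    proof (cases "s \<in> {0<..<t}")
      case True
      then have "summable (\<lambda>n. \<bar>e n s\<bar> / (t - s) powr \<beta>)"
        using e_abs[of s] by (intro summable_divide) auto
      with True show ?thesis by (simp add: h_eq)
    qed (simp add: h_eq)
    have h_suminf: "(\<Sum>n. h n s) = indicator {0<..<t} s * (deriv f s / (t - s) powr \<beta>)" for s
      using summable_rabs_cancel[OF e_abs[of s]] deriv[of s]
      by (cases "s \<in> {0<..<t}") (auto simp: h_eq suminf_divide)
    have int1: "integrable lborel (h n)" for n using h[of n] by (auto simp: has_bochner_integral_iff)
    have sum_norm: "summable (\<lambda>n. \<integral>s. norm (h n s) \<partial>lborel)"
      using h_abs summable_mult[OF sum, of "Gamma (1 - \<beta>)"] by (simp add: has_bochner_integral_iff)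
    have "integrable lborel (\<lambda>s. \<Sum>n. h n s)"
      by (intro integrable_suminf int1 sum_norm AE_I2 h_summable)
    moreover have "(\<integral>s. (\<Sum>n. h n s) \<partial>lborel) = (\<Sum>n. \<integral>s. h n s \<partial>lborel)"
      by (intro integral_suminf int1 sum_norm AE_I2 h_summable)
    moreover have "(\<Sum>n. \<integral>s. h n s \<partial>lborel) =
        Gamma (1 - \<beta>) * (\<Sum>n. c (n + m) * (t powr \<nu>) ^ n / Gamma (\<nu> * real n + 1))"
    proof -
      have "(\<integral>s. h n s \<partial>lborel) = Gamma (1 - \<beta>) * (c (n + m) * (t powr \<nu>) ^ n / Gamma (\<nu> * real n + 1))" for n
        using h[of n] by (simp only: has_bochner_integral_iff int_h)
      moreover have "summable (\<lambda>n. c (n + m) * (t powr \<nu>) ^ n / Gamma (\<nu> * real n + 1))"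
      proof (rule summable_rabs_cancel)
        have "0 < Gamma (\<nu> * real n + 1)" for n
          using \<nu> by (intro Gamma_real_pos) (simp add: add_nonneg_pos)
        then show "summable (\<lambda>n. \<bar>c (n + m) * (t powr \<nu>) ^ n / Gamma (\<nu> * real n + 1)\<bar>)"
          using sum by (simp add: abs_mult abs_of_pos)
      qed
      ultimately show ?thesis by (simp only: suminf_mult)
    qed
    moreover have "Gamma (1 - \<beta>) \<noteq> 0"
      using order_less_imp_not_eq2[OF Gamma_real_pos[of "1 - \<beta>"]] \<beta>1 by simp
    ultimately show ?thesis
      using \<beta>1
      by (simp add: h_suminf caputo_deriv_def set_integrable_def set_lebesgue_integral_def
          fractional_power_series_def)
  qed
  then show "caputo_differentiable (\<nu> * real m) f t"
    using f_cont f_diff t by (auto simp: caputo_differentiable_def \<beta>_def)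
  from main show "caputo_deriv (\<nu> * real m) f t = fractional_power_series \<nu> (\<lambda>n. c (n + m)) t"
    by (simp add: \<beta>_def)
qed

text \<open>
  Integration term by term is justified because the transforms of the absolute values are dominated by a geometric series of
  ratio \<open>R s\<^bsup>-\<nu>\<^esup> < 1\<close>.
\<close>
lemma fractional_power_series_laplace:
  assumes s: "0 < s" "R < s powr \<nu>"
  shows "has_bochner_integral lborel
    (\<lambda>t. indicator {0<..} t * (exp (- (s * t)) * fractional_power_series \<nu> c t))
    ((\<Sum>n. c n * (s powr - \<nu>) ^ n) / s)"
    and "summable (\<lambda>n. c n * (s powr - \<nu>) ^ n)"
proof -
  define q where "q = s powr - \<nu>"
  have q: "0 < q" "R * q < 1" using s by (auto simp: q_def powr_minus field_simps)
  have sum: "summable (\<lambda>n. \<bar>c n\<bar> * q ^ n)"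
  proof (rule summable_comparison_test')
    show "summable (\<lambda>n. (R * q) ^ n)" using q R by (intro summable_geometric) auto
    fix n :: nat
    show "norm (\<bar>c n\<bar> * q ^ n) \<le> (R * q) ^ n"
      using c[of n] q by (simp add: power_mult_distrib abs_mult mult_right_mono)
  qed
  then have sum': "summable (\<lambda>n. c n * q ^ n)"
    using q by (intro summable_rabs_cancel[of "\<lambda>n. c n * q ^ n"]) (simp add: abs_mult)
  then show "summable (\<lambda>n. c n * (s powr - \<nu>) ^ n)" by (simp add: q_def)
  have G: "0 < Gamma (\<nu> * real n + 1)" for n
    using \<nu> by (intro Gamma_real_pos) (simp add: add_nonneg_pos)
  define b where "b = (\<lambda>n t. indicator {0<..} t * (t powr (\<nu> * real n) * exp (- (s * t))))"
  have b_nonneg: "0 \<le> b n t" for n t by (simp add: b_def)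
  have b: "has_bochner_integral lborel (b n) (Gamma (\<nu> * real n + 1) * (q ^ n / s))" for n
  proof -
    have "Gamma (\<nu> * real n + 1) / s powr (\<nu> * real n + 1) = Gamma (\<nu> * real n + 1) * (q ^ n / s)"
      using s by (simp add: q_def powr_add powr_power powr_minus field_simps)
    then show ?thesis
      using has_bochner_integral_Gamma_scaled[of "\<nu> * real n" s] \<nu> s by (simp add: b_def)
  qed
  define h where "h = (\<lambda>n t. c n / Gamma (\<nu> * real n + 1) * b n t)"
  have h: "has_bochner_integral lborel (h n) (c n * q ^ n / s)" for n
    using has_bochner_integral_mult_right[OF b, of "c n / Gamma (\<nu> * real n + 1)" n] G[of n]
    by (simp add: h_def)
  have h_abs: "has_bochner_integral lborel (\<lambda>t. norm (h n t)) (\<bar>c n\<bar> * q ^ n / s)" for n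
    using has_bochner_integral_mult_right[OF b, of "\<bar>c n\<bar> / Gamma (\<nu> * real n + 1)" n] G[of n]
      b_nonneg[of n]
    by (simp add: h_def abs_mult)
  have h_eq: "h n t = indicator {0<..} t * exp (- (s * t)) * (c n * (t powr \<nu>) ^ n / Gamma (\<nu> * real n + 1))" for n t
    by (auto simp: h_def b_def powr_power mult_ac split: split_indicator)
  have f_abs: "summable (\<lambda>n. \<bar>c n * (t powr \<nu>) ^ n / Gamma (\<nu> * real n + 1)\<bar>)" for t
    using summable_coeff_over_Gamma[of \<nu> R c "t powr \<nu>"] \<nu> R c by auto
  have h_summable: "summable (\<lambda>n. norm (h n t))" for t
  proof -
    have "norm (h n t) = indicator {0<..} t * exp (- (s * t)) *
        \<bar>c n * (t powr \<nu>) ^ n / Gamma (\<nu> * real n + 1)\<bar>" for n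
      unfolding h_eq real_norm_def abs_mult[of "_ * _"] by simp
    then show ?thesis by (simp only: summable_mult[OF f_abs])
  qed
  have h_suminf: "(\<Sum>n. h n t) = indicator {0<..} t * (exp (- (s * t)) * fractional_power_series \<nu> c t)" for t
    unfolding h_eq fractional_power_series_def
    by (subst suminf_mult[OF summable_rabs_cancel[OF f_abs]]) (simp add: mult_ac)
  have int1: "integrable lborel (h n)" for n using h[of n] by (auto simp: has_bochner_integral_iff)
  have sum_norm: "summable (\<lambda>n. \<integral>t. norm (h n t) \<partial>lborel)"
    using h_abs summable_divide[OF sum, of s] by (simp add: has_bochner_integral_iff)
  have "integrable lborel (\<lambda>t. \<Sum>n. h n t)"
    by (intro integrable_suminf int1 sum_norm AE_I2 h_summable)
  moreover have "(\<integral>t. (\<Sum>n. h n t) \<partial>lborel) = (\<Sum>n. \<integral>t. h n t \<partial>lborel)"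
    by (intro integral_suminf int1 sum_norm AE_I2 h_summable)
  moreover have "(\<Sum>n. \<integral>t. h n t \<partial>lborel) = (\<Sum>n. c n * q ^ n) / s"
    using h by (simp add: has_bochner_integral_iff suminf_divide[OF sum'])
  ultimately show "has_bochner_integral lborel
    (\<lambda>t. indicator {0<..} t * (exp (- (s * t)) * fractional_power_series \<nu> c t))
    ((\<Sum>n. c n * (s powr - \<nu>) ^ n) / s)"
    by (simp add: has_bochner_integral_iff h_suminf q_def)
qed

end

section \<open>The characteristic recurrence and its fractional relaxation function\<close>

text \<open>
  The Taylor coefficients of \<open>(1 + 2\<lambda>q) / (1 + 2\<lambda>q + \<gamma>q\<^sup>2)\<close>; see
  \<open>telegraph_coeff_generating_function\<close>. The function \<open>\<Sum> c\<^sub>n t\<^sup>n / n!\<close> solves \<open>f'' + 2\<lambda>f' + \<gamma>f = 0\<close>,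
  \<open>f(0) = 1\<close>, \<open>f'(0) = 0\<close>, the equation satisfied by the characteristic function of the telegraph
  process.
\<close>
fun telegraph_coeff :: "real \<Rightarrow> real \<Rightarrow> nat \<Rightarrow> real" where
  "telegraph_coeff lam \<gamma> 0 = 1"
| "telegraph_coeff lam \<gamma> (Suc 0) = 0"
| "telegraph_coeff lam \<gamma> (Suc (Suc n)) =
     - 2 * lam * telegraph_coeff lam \<gamma> (Suc n) - \<gamma> * telegraph_coeff lam \<gamma> n"

lemma abs_telegraph_coeff_le:
  assumes "0 \<le> lam" "0 \<le> \<gamma>"
  shows "\<bar>telegraph_coeff lam \<gamma> n\<bar> \<le> (1 + 2 * lam + \<gamma>) ^ n"
proof (induction n rule: induct_nat_012)
  case (ge2 n)
  define R where "R = 1 + 2 * lam + \<gamma>"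
  have R: "1 \<le> R" "2 * lam \<ge> 0" "\<gamma> \<ge> 0" using assms by (auto simp: R_def)
  have "\<bar>telegraph_coeff lam \<gamma> (Suc (Suc n))\<bar>
      \<le> 2 * lam * \<bar>telegraph_coeff lam \<gamma> (Suc n)\<bar> + \<gamma> * \<bar>telegraph_coeff lam \<gamma> n\<bar>"
    using R by (auto simp: abs_mult intro!: order_trans[OF abs_triangle_ineq4])
  also have "\<dots> \<le> 2 * lam * R ^ Suc n + \<gamma> * R ^ n"
    using ge2 R unfolding R_def by (intro add_mono mult_left_mono) auto
  also have "\<dots> \<le> 2 * lam * R ^ Suc n + \<gamma> * R ^ Suc n"
    using R by (intro add_left_mono mult_left_mono power_increasing) auto
  also have "\<dots> \<le> R ^ Suc (Suc n)"
    using R by (simp add: R_def algebra_simps)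
  finally show ?case by (simp add: R_def)
qed (use assms in auto)

lemma telegraph_coeff_eq_power_combination:
  fixes w :: complex
  assumes w: "w\<^sup>2 = of_real (lam\<^sup>2 - \<gamma>)" "w \<noteq> 0"
    and r: "r1 = - of_real lam + w" "r2 = - of_real lam - w"
  shows "of_real (telegraph_coeff lam \<gamma> n) =
    1 / 2 * ((1 + of_real lam / w) * r1 ^ n + (1 - of_real lam / w) * r2 ^ n)"
proof (induction n rule: induct_nat_012)
  case 1
  then show ?case using w(2) by (simp add: r field_simps)
next
  case (ge2 n)
  have root: "r ^ Suc (Suc n) = - 2 * of_real lam * r ^ Suc n - of_real \<gamma> * r ^ n"
    if "r = r1 \<or> r = r2" for r
  proof -
    have "r\<^sup>2 = - 2 * of_real lam * r - of_real \<gamma>"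
      using that w(1) unfolding r by (elim disjE; hypsubst; simp add: power2_eq_square algebra_simps)
    then have "r ^ n * r\<^sup>2 = r ^ n * (- 2 * of_real lam * r - of_real \<gamma>)" by simp
    then show ?thesis by (simp add: power2_eq_square algebra_simps)
  qed
  have "of_real (telegraph_coeff lam \<gamma> (Suc (Suc n))) =
      - 2 * of_real lam * complex_of_real (telegraph_coeff lam \<gamma> (Suc n))
      - of_real \<gamma> * of_real (telegraph_coeff lam \<gamma> n)" by simp
  also have "\<dots> = 1 / 2 * ((1 + of_real lam / w) * r1 ^ Suc (Suc n)
      + (1 - of_real lam / w) * r2 ^ Suc (Suc n))"
    using ge2 by (simp only: root simp_thms) (simp add: algebra_simps)
  finally show ?case .
qed auto

lemma sum_homogeneous_Suc:
  fixes x y :: "'b :: comm_ring_1"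
  shows "(\<Sum>i\<le>Suc n. x ^ i * y ^ (Suc n - i)) = y * (\<Sum>i\<le>n. x ^ i * y ^ (n - i)) + x ^ Suc n"
  by (auto simp: sum_distrib_left Suc_diff_le mult_ac intro!: sum.cong)

lemma sum_homogeneous_Suc':
  fixes x y :: "'b :: comm_ring_1"
  shows "(\<Sum>i\<le>Suc n. x ^ i * y ^ (Suc n - i)) = x * (\<Sum>i\<le>n. x ^ i * y ^ (n - i)) + y ^ Suc n"
  by (subst sum.atMost_Suc_shift) (simp add: sum_distrib_left mult_ac)

text \<open>
  The complete homogeneous polynomials \<open>h\<^sub>n\<close> of the roots are the coefficients of
  \<open>1 / ((1 - r\<^sub>1 q) (1 - r\<^sub>2 q))\<close>; multiplying by the numerator \<open>1 + 2\<lambda>q\<close> adds \<open>2\<lambda> h\<^sub>n\<^sub>-\<^sub>1\<close>. Nothing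
  is divided by \<open>r\<^sub>1 - r\<^sub>2\<close>, so a double root is allowed.
\<close>
lemma telegraph_coeff_Suc_eq_homogeneous:
  fixes w :: complex
  assumes w: "w\<^sup>2 = of_real (lam\<^sup>2 - \<gamma>)"
    and r: "r1 = - of_real lam + w" "r2 = - of_real lam - w"
  defines "h \<equiv> \<lambda>n. \<Sum>i\<le>n. r1 ^ i * r2 ^ (n - i)"
  shows "of_real (telegraph_coeff lam \<gamma> (Suc n)) = h (Suc n) + 2 * of_real lam * h n"
proof -
  have h0: "h 0 = 1" by (simp add: h_def)
  have hS: "h (Suc n) = r2 * h n + r1 ^ Suc n" "h (Suc n) = r1 * h n + r2 ^ Suc n" for n
    unfolding h_def using sum_homogeneous_Suc sum_homogeneous_Suc' by blast+
  have sum: "r1 + r2 = - 2 * of_real lam" and prod: "r1 * r2 = of_real \<gamma>"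
    unfolding r using w by (simp_all add: algebra_simps power2_eq_square)
  have rec: "h (Suc (Suc n)) = - 2 * of_real lam * h (Suc n) - of_real \<gamma> * h n" for n
  proof -
    have "h (Suc (Suc n)) = r2 * h (Suc n) + r1 * r1 ^ Suc n"
      using hS(1)[of "Suc n"] by simp
    also have "r1 ^ Suc n = h (Suc n) - r2 * h n" using hS(1)[of n] by simp
    also have "r2 * h (Suc n) + r1 * (h (Suc n) - r2 * h n) = (r1 + r2) * h (Suc n) - r1 * r2 * h n"
      by (simp add: algebra_simps)
    finally show ?thesis by (simp only: sum prod)
  qed
  have h1: "h (Suc 0) = - 2 * of_real lam"
    using hS(1)[of 0] h0 sum by (simp add: add.commute)
  show ?thesis
  proof (induction n rule: less_induct)
    case (less n)
    consider "n = 0" | "n = 1" | m where "n = Suc (Suc m)"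
      by (metis One_nat_def not0_implies_Suc)
    then show ?case
    proof cases
      case 3
      have "complex_of_real (telegraph_coeff lam \<gamma> (Suc n)) =
          - 2 * of_real lam * of_real (telegraph_coeff lam \<gamma> (Suc (Suc m)))
          - of_real \<gamma> * of_real (telegraph_coeff lam \<gamma> (Suc m))"
        unfolding 3 by simp
      also have "\<dots> = - 2 * of_real lam * (h (Suc (Suc m)) + 2 * of_real lam * h (Suc m))
          - of_real \<gamma> * (h (Suc m) + 2 * of_real lam * h m)"
        using less[of "Suc m"] less[of m] 3 by simp
      also have "\<dots> = h (Suc n) + 2 * of_real lam * h n"
      proof -
        have e: "h (Suc (Suc m)) + 2 * of_real lam * h (Suc m) = - of_real \<gamma> * h m"
          using rec[of m] by simp
        show ?thesis unfolding 3 e rec[of "Suc m"] by (simp add: algebra_simps)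
      qed
      finally show ?thesis .
    qed (use h0 h1 rec[of 0] in \<open>simp_all add: algebra_simps\<close>)
  qed
qed

lemma telegraph_coeff_generating_function:
  assumes "summable (\<lambda>n. telegraph_coeff lam \<gamma> n * q ^ n)"
  shows "(1 + 2 * lam * q + \<gamma> * q\<^sup>2) * (\<Sum>n. telegraph_coeff lam \<gamma> n * q ^ n) = 1 + 2 * lam * q"
proof -
  define a where "a = (\<lambda>n. telegraph_coeff lam \<gamma> n * q ^ n)"
  define C where "C = suminf a"
  have a_rec: "a (Suc (Suc n)) = (- 2 * lam * q) * a (Suc n) + (- \<gamma> * q\<^sup>2) * a n" for n
    by (simp add: a_def power2_eq_square algebra_simps)
  have a0: "a sums C" using assms by (simp add: C_def a_def summable_sums)
  then have a1: "(\<lambda>n. a (Suc n)) sums (C - 1)"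
    using sums_Suc_iff[of a "C - 1"] by (simp add: a_def)
  then have "(\<lambda>n. a (Suc (Suc n))) sums (C - 1)"
    using sums_Suc_iff[of "\<lambda>n. a (Suc n)" "C - 1"] by (simp add: a_def)
  moreover have "(\<lambda>n. a (Suc (Suc n))) sums ((- 2 * lam * q) * (C - 1) + (- \<gamma> * q\<^sup>2) * C)"
    unfolding a_rec by (intro sums_add sums_mult a0 a1)
  ultimately have "C - 1 = (- 2 * lam * q) * (C - 1) + (- \<gamma> * q\<^sup>2) * C"
    by (rule sums_unique2)
  then have "(1 + 2 * lam * q + \<gamma> * q\<^sup>2) * C = 1 + 2 * lam * q" by (simp add: algebra_simps)
  then show ?thesis by (simp only: C_def a_def)
qed

lemma telegraph_coeff_bound:
  assumes "0 < lam" "0 < \<gamma>"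
  shows "0 \<le> 1 + 2 * lam + \<gamma>" "\<bar>telegraph_coeff lam \<gamma> n\<bar> \<le> (1 + 2 * lam + \<gamma>) ^ n"
  using abs_telegraph_coeff_le[of lam \<gamma> n] assms by auto

context
  fixes \<nu> lam \<gamma> :: real
  assumes \<nu>: "0 < \<nu>" and lam: "0 < lam" and \<gamma>: "0 < \<gamma>"
begin

abbreviation (input) telegraph_relaxation :: "real \<Rightarrow> real" where
  "telegraph_relaxation \<equiv> fractional_power_series \<nu> (telegraph_coeff lam \<gamma>)"

text \<open>
  The recurrence of the coefficients, read through the shifts by \<open>2\<close> and by \<open>1\<close> that the two Caputo
  derivatives perform.
\<close>
lemma telegraph_relaxation_caputo:
  assumes "\<nu> \<le> 1 / 2" and f: "\<And>t. 0 \<le> t \<Longrightarrow> f t = telegraph_relaxation t" and t: "0 < t"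
  shows "caputo_differentiable (2 * \<nu>) f t" "caputo_differentiable \<nu> f t"
    and "caputo_deriv (2 * \<nu>) f t + 2 * lam * caputo_deriv \<nu> f t = - \<gamma> * f t"
proof -
  let ?c = "telegraph_coeff lam \<gamma>"
  note caputo = fractional_power_series_caputo[OF \<nu> telegraph_coeff_bound[OF lam \<gamma>], of _ f t]
  have zero: "?c n = 0" if "0 < n" "n < 2" for n
    using that by (simp add: less_2_cases_iff)
  show d2: "caputo_differentiable (2 * \<nu>) f t" and d1: "caputo_differentiable \<nu> f t"
    using caputo(1)[of 2] caputo(1)[of 1] assms zero by (simp_all add: mult.commute)
  have e2: "caputo_deriv (2 * \<nu>) f t = fractional_power_series \<nu> (\<lambda>n. ?c (n + 2)) t"
    using caputo(2)[of 2] assms zero by (simp add: mult.commute)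
  have e1: "caputo_deriv \<nu> f t = fractional_power_series \<nu> (\<lambda>n. ?c (n + 1)) t"
    using caputo(2)[of 1] assms by simp
  have sums: "(\<lambda>n. ?c (n + m) * (t powr \<nu>) ^ n / Gamma (\<nu> * real n + 1)) sums
      fractional_power_series \<nu> (\<lambda>n. ?c (n + m)) t" for m
  proof -
    have "summable (\<lambda>n. \<bar>?c (n + m)\<bar> * (t powr \<nu>) ^ n / Gamma (\<nu> * real n + 1))"
      by (rule fractional_power_series_shift_summable[OF \<nu> telegraph_coeff_bound[OF lam \<gamma>]]) simp
    moreover have "0 < Gamma (\<nu> * real n + 1)" for n
      using \<nu> by (intro Gamma_real_pos) (simp add: add_nonneg_pos)
    ultimately have "summable (\<lambda>n. \<bar>?c (n + m) * (t powr \<nu>) ^ n / Gamma (\<nu> * real n + 1)\<bar>)"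
      by (simp add: abs_mult abs_of_pos)
    then show ?thesis
      by (simp add: fractional_power_series_def summable_sums summable_rabs_cancel)
  qed
  have "(\<lambda>n. ?c (n + 2) * (t powr \<nu>) ^ n / Gamma (\<nu> * real n + 1)
      + 2 * lam * (?c (n + 1) * (t powr \<nu>) ^ n / Gamma (\<nu> * real n + 1))) sums
      (caputo_deriv (2 * \<nu>) f t + 2 * lam * caputo_deriv \<nu> f t)"
    unfolding e1 e2 by (intro sums_add sums_mult sums)
  moreover have "(\<lambda>n. - \<gamma> * (?c (n + 0) * (t powr \<nu>) ^ n / Gamma (\<nu> * real n + 1))) sums (- \<gamma> * f t)"
    using sums_mult[OF sums[of 0], of "- \<gamma>"] f[of t] t by simp
  moreover have "?c (n + 2) * (t powr \<nu>) ^ n / Gamma (\<nu> * real n + 1)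
      + 2 * lam * (?c (n + 1) * (t powr \<nu>) ^ n / Gamma (\<nu> * real n + 1)) =
      - \<gamma> * (?c (n + 0) * (t powr \<nu>) ^ n / Gamma (\<nu> * real n + 1))" for n
    by (simp add: add_divide_distrib diff_divide_distrib algebra_simps)
  ultimately show "caputo_deriv (2 * \<nu>) f t + 2 * lam * caputo_deriv \<nu> f t = - \<gamma> * f t"
    by (simp only: sums_unique2)
qed

lemma telegraph_relaxation_laplace:
  assumes "0 < s" "1 + 2 * lam + \<gamma> < s powr \<nu>"
  shows "has_bochner_integral lborel
    (\<lambda>t. indicator {0<..} t * (exp (- (s * t)) * telegraph_relaxation t))
    ((s powr (2 * \<nu>) + 2 * lam * s powr \<nu>) / (\<gamma> + (s powr (2 * \<nu>) + 2 * lam * s powr \<nu>)) / s)"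
proof -
  note L = fractional_power_series_laplace[OF \<nu> telegraph_coeff_bound[OF lam \<gamma>] assms]
  define p where "p = s powr \<nu>"
  define C where "C = (\<Sum>n. telegraph_coeff lam \<gamma> n * (s powr - \<nu>) ^ n)"
  have p: "0 < p" "s powr - \<nu> = 1 / p" "s powr (2 * \<nu>) = p\<^sup>2"
    using assms by (simp_all add: p_def powr_minus_divide powr_power mult.commute)
  have "(1 + 2 * lam * (1 / p) + \<gamma> * (1 / p)\<^sup>2) * C = 1 + 2 * lam * (1 / p)"
    using telegraph_coeff_generating_function[OF L(2)] unfolding C_def p(2) .
  moreover have "p\<^sup>2 * (1 + 2 * lam * (1 / p) + \<gamma> * (1 / p)\<^sup>2) = p\<^sup>2 + 2 * lam * p + \<gamma>"
    "p\<^sup>2 * (1 + 2 * lam * (1 / p)) = p\<^sup>2 + 2 * lam * p"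
    using p(1) by (simp_all add: field_simps power2_eq_square)
  ultimately have "(p\<^sup>2 + 2 * lam * p + \<gamma>) * C = p\<^sup>2 + 2 * lam * p"
    by (metis mult.assoc)
  moreover have "0 < p\<^sup>2 + 2 * lam * p + \<gamma>" using p lam \<gamma> by (simp add: add_pos_pos)
  ultimately have "C = (p\<^sup>2 + 2 * lam * p) / (\<gamma> + (p\<^sup>2 + 2 * lam * p))"
    by (simp add: field_simps)
  with L(1) show ?thesis unfolding C_def[symmetric] p(3) p_def[symmetric] by simp
qed

lemma telegraph_relaxation_mittag_leffler:
  fixes w r1 r2 :: complex
  assumes w: "w\<^sup>2 = of_real (lam\<^sup>2 - \<gamma>)" and r: "r1 = - of_real lam + w" "r2 = - of_real lam - w"
  shows "w \<noteq> 0 \<Longrightarrow> of_real (telegraph_relaxation t) =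
      1 / 2 * ((1 + of_real lam / w) * mittag_leffler \<nu> 1 (r1 * of_real (t powr \<nu>))
        + (1 - of_real lam / w) * mittag_leffler \<nu> 1 (r2 * of_real (t powr \<nu>)))"
    and "of_real (telegraph_relaxation t) =
      mittag_leffler2 \<nu> 1 1 1 (r1 * of_real (t powr \<nu>)) (r2 * of_real (t powr \<nu>))
      + 2 * of_real lam * of_real (t powr \<nu>)
        * mittag_leffler2 \<nu> (\<nu> + 1) 1 1 (r1 * of_real (t powr \<nu>)) (r2 * of_real (t powr \<nu>))"
proof -
  define x where "x = complex_of_real (t powr \<nu>)"
  let ?c = "\<lambda>n. complex_of_real (telegraph_coeff lam \<gamma> n)"
  let ?G = "\<lambda>n. complex_of_real (Gamma (\<nu> * real n + 1))"
  have "norm (?c n) \<le> (1 + 2 * lam + \<gamma>) ^ n" for n using telegraph_coeff_bound(2)[OF lam \<gamma>] by simp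
  from summable_coeff_over_Gamma[OF \<nu> telegraph_coeff_bound(1)[OF lam \<gamma>] this]
  have "summable (\<lambda>n. ?c n * x ^ n / ?G n)" by (rule summable_norm_cancel)
  moreover have "summable (\<lambda>n. telegraph_coeff lam \<gamma> n * (t powr \<nu>) ^ n / Gamma (\<nu> * real n + 1))"
    using summable_coeff_over_Gamma[OF \<nu> telegraph_coeff_bound(1)[OF lam \<gamma>], of "telegraph_coeff lam \<gamma>" "t powr \<nu>"]
      telegraph_coeff_bound(2)[OF lam \<gamma>] summable_norm_cancel by fastforce
  ultimately have sums: "(\<lambda>n. ?c n * x ^ n / ?G n) sums of_real (telegraph_relaxation t)"
    using suminf_of_real[of "\<lambda>n. telegraph_coeff lam \<gamma> n * (t powr \<nu>) ^ n / Gamma (\<nu> * real n + 1)",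
        where ?'a = complex]
    by (simp add: sums_iff x_def fractional_power_series_def)
  show "of_real (telegraph_relaxation t) =
      1 / 2 * ((1 + of_real lam / w) * mittag_leffler \<nu> 1 (r1 * of_real (t powr \<nu>))
        + (1 - of_real lam / w) * mittag_leffler \<nu> 1 (r2 * of_real (t powr \<nu>)))" if "w \<noteq> 0"
  proof -
    define A B where "A = 1 + complex_of_real lam / w" and "B = 1 - complex_of_real lam / w"
    have "(\<lambda>n. 1 / 2 * (A * (r1 ^ n * x ^ n / ?G n) + B * (r2 ^ n * x ^ n / ?G n)))
        sums (1 / 2 * (A * mittag_leffler \<nu> 1 (r1 * x) + B * mittag_leffler \<nu> 1 (r2 * x)))"
      by (intro sums_mult sums_add mittag_leffler_sums \<nu>)
    moreover have "1 / 2 * (A * (r1 ^ n * x ^ n / ?G n) + B * (r2 ^ n * x ^ n / ?G n)) = ?c n * x ^ n / ?G n" for n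
      unfolding telegraph_coeff_eq_power_combination[OF w that r] A_def[symmetric] B_def[symmetric]
      by (simp add: add_divide_distrib algebra_simps)
    ultimately show ?thesis using sums_unique2[OF sums] by (simp add: x_def A_def B_def)
  qed
  define h where "h = (\<lambda>n. \<Sum>i\<le>n. r1 ^ i * r2 ^ (n - i))"
  have s1: "(\<lambda>n. h n * x ^ n / ?G n) sums mittag_leffler2 \<nu> 1 1 1 (r1 * x) (r2 * x)"
    unfolding h_def using summable_power_over_Gamma[OF \<nu>] \<nu>
    by (intro mittag_leffler2_sums) (auto intro: less_imp_le)
  have s2: "(\<lambda>n. h n * x ^ n / complex_of_real (Gamma (\<nu> * real n + (\<nu> + 1)))) sums
      mittag_leffler2 \<nu> (\<nu> + 1) 1 1 (r1 * x) (r2 * x)"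
    unfolding h_def using summable_power_over_Gamma_shift[OF \<nu>] \<nu>
    by (intro mittag_leffler2_sums) auto
  have "(\<lambda>n. h (Suc n) * x ^ Suc n / ?G (Suc n)) sums (mittag_leffler2 \<nu> 1 1 1 (r1 * x) (r2 * x) - 1)"
    using s1 sums_Suc_iff[of "\<lambda>n. h n * x ^ n / ?G n" "mittag_leffler2 \<nu> 1 1 1 (r1 * x) (r2 * x) - 1"]
    by (simp add: h_def)
  then have "(\<lambda>n. h (Suc n) * x ^ Suc n / ?G (Suc n)
      + 2 * of_real lam * x * (h n * x ^ n / complex_of_real (Gamma (\<nu> * real n + (\<nu> + 1))))) sums
      (mittag_leffler2 \<nu> 1 1 1 (r1 * x) (r2 * x) - 1
      + 2 * of_real lam * x * mittag_leffler2 \<nu> (\<nu> + 1) 1 1 (r1 * x) (r2 * x))"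
    using s2 by (intro sums_add sums_mult)
  moreover have "h (Suc n) * x ^ Suc n / ?G (Suc n)
      + 2 * of_real lam * x * (h n * x ^ n / complex_of_real (Gamma (\<nu> * real n + (\<nu> + 1)))) =
      ?c (Suc n) * x ^ Suc n / ?G (Suc n)" for n
  proof -
    have G: "Gamma (\<nu> * real n + (\<nu> + 1)) = Gamma (\<nu> * real (Suc n) + 1)"
      by (simp add: algebra_simps)
    have c: "?c (Suc n) = h (Suc n) + 2 * of_real lam * h n"
      using telegraph_coeff_Suc_eq_homogeneous[OF w r] by (simp only: h_def)
    show ?thesis
      unfolding c G
      by (simp add: add_divide_distrib algebra_simps del: of_nat_Suc)
  qed
  moreover have "(\<lambda>n. ?c (Suc n) * x ^ Suc n / ?G (Suc n)) sums (of_real (telegraph_relaxation t) - 1)"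
    using sums sums_Suc_iff[of "\<lambda>n. ?c n * x ^ n / ?G n" "of_real (telegraph_relaxation t) - 1"] by simp
  ultimately show "of_real (telegraph_relaxation t) =
      mittag_leffler2 \<nu> 1 1 1 (r1 * of_real (t powr \<nu>)) (r2 * of_real (t powr \<nu>))
      + 2 * of_real lam * of_real (t powr \<nu>)
        * mittag_leffler2 \<nu> (\<nu> + 1) 1 1 (r1 * of_real (t powr \<nu>)) (r2 * of_real (t powr \<nu>))"
    using sums_unique2 by (fastforce simp: x_def)
qed

end

section \<open>Uniqueness of Laplace transforms and joint measurability\<close>

text \<open>
  Vanishing along the arithmetic progression \<open>\<sigma> + n\<close> says that \<open>exp (- \<sigma> t) f t\<close> is orthogonal to
  all polynomials in \<open>exp (- t)\<close>, hence by Weierstrass to all continuous functions of \<open>exp (- t)\<close>.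
  A bump supported just to the left of a point where \<open>f \<noteq> 0\<close> then gives a contradiction, since by
  left-continuity \<open>f\<close> has constant sign there.
\<close>
lemma laplace_transform_zero_imp_zero:
  fixes f :: "real \<Rightarrow> real" and \<sigma> :: real
  assumes int: "integrable lborel (\<lambda>t. indicator {0<..} t * (exp (- (\<sigma> * t)) * f t))"
    and zero: "\<And>n::nat. (\<integral>t. indicator {0<..} t * (exp (- ((\<sigma> + real n) * t)) * f t) \<partial>lborel) = 0"
    and left: "\<And>t. 0 < t \<Longrightarrow> (f \<longlongrightarrow> f t) (at_left t)"
    and t: "0 < t"
  shows "f t = 0"
proof (rule ccontr)
  assume "f t \<noteq> 0"
  define F where "F = (\<lambda>t. indicator {0<..} t * (exp (- (\<sigma> * t)) * f t))"
  have F[measurable]: "F \<in> borel_measurable lborel" and F_int: "integrable lborel F"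
    using int by (auto simp: F_def)
  have bounded_int: "integrable lborel (\<lambda>t. \<phi> (exp (- t)) * F t)"
    if "continuous_on UNIV \<phi>" for \<phi> :: "real \<Rightarrow> real"
  proof -
    have [measurable]: "\<phi> \<in> borel_measurable borel"
      using that by (rule borel_measurable_continuous_onI)
    have "bounded (\<phi> ` {0..1})"
      by (intro compact_imp_bounded compact_continuous_image continuous_on_subset[OF that]) auto
    then obtain B where B: "\<And>y. y \<in> {0..1} \<Longrightarrow> \<bar>\<phi> y\<bar> \<le> B"
      unfolding bounded_iff by force
    show ?thesis
    proof (rule Bochner_Integration.integrable_bound)
      show "integrable lborel (\<lambda>t. B * F t)" by (intro integrable_mult_right F_int)
      have "norm (\<phi> (exp (- t)) * F t) \<le> norm (B * F t)" for t
      proof (cases "0 < t")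
        case True
        then have "\<bar>\<phi> (exp (- t))\<bar> \<le> B" by (intro B) auto
        then show ?thesis by (auto simp: abs_mult intro!: mult_right_mono)
      qed (simp add: F_def)
      then show "AE t in lborel. norm (\<phi> (exp (- t)) * F t) \<le> norm (B * F t)" by simp
    qed simp
  qed
  have monomial: "(\<integral>t. exp (- t) ^ n * F t \<partial>lborel) = 0" for n
    using zero[of n] by (simp add: F_def exp_of_nat_mult[symmetric] algebra_simps mult_exp_exp)
  have polynomial: "(\<integral>t. p (exp (- t)) * F t \<partial>lborel) = 0" if p_poly: "real_polynomial_function p" for p
  proof -
    obtain a n where p: "p = (\<lambda>x. \<Sum>i\<le>n. a i * x ^ i)"
      using p_poly unfolding real_polynomial_function_iff_sum by blast
    have "integrable lborel (\<lambda>t. exp (- t) ^ i * F t)" for i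
      by (rule bounded_int) (intro continuous_intros)
    then have "integrable lborel (\<lambda>t. a i * (exp (- t) ^ i * F t))" for i
      by (rule integrable_mult_right)
    then have "(\<integral>t. p (exp (- t)) * F t \<partial>lborel) = (\<Sum>i\<le>n. a i * (\<integral>t. exp (- t) ^ i * F t \<partial>lborel))"
      by (simp add: p sum_distrib_right mult.assoc Bochner_Integration.integral_sum)
    then show ?thesis by (simp add: monomial)
  qed
  have continuous: "(\<integral>t. \<phi> (exp (- t)) * F t \<partial>lborel) = 0"
    if \<phi>: "continuous_on UNIV \<phi>" for \<phi> :: "real \<Rightarrow> real"
  proof -
    have "\<bar>\<integral>t. \<phi> (exp (- t)) * F t \<partial>lborel\<bar> \<le> 0 + \<epsilon>" if "0 < \<epsilon>" for \<epsilon>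
    proof -
      define C where "C = (\<integral>t. \<bar>F t\<bar> \<partial>lborel) + 1"
      have C: "0 < C" unfolding C_def by (intro add_nonneg_pos integral_nonneg) auto
      obtain p where p: "real_polynomial_function p" "\<And>y. y \<in> {0..1} \<Longrightarrow> \<bar>\<phi> y - p y\<bar> < \<epsilon> / C"
        using Stone_Weierstrass_real_polynomial_function[of "{0..1}" \<phi> "\<epsilon> / C"]
          continuous_on_subset[OF \<phi>] C \<open>0 < \<epsilon>\<close> by auto
      have p_cont: "continuous_on UNIV p"
        using p(1) by (simp add: continuous_on_polymonial_function real_polynomial_function_eq)
      have "(\<integral>t. \<phi> (exp (- t)) * F t \<partial>lborel) = (\<integral>t. (\<phi> (exp (- t)) - p (exp (- t))) * F t \<partial>lborel)"
        using polynomial[OF p(1)] bounded_int[OF \<phi>] bounded_int[OF p_cont]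
        by (simp add: left_diff_distrib)
      also have "\<bar>\<dots>\<bar> \<le> (\<integral>t. (\<epsilon> / C) * \<bar>F t\<bar> \<partial>lborel)"
      proof (rule integral_abs_bound[THEN order_trans], rule integral_mono)
        show "integrable lborel (\<lambda>t. \<bar>(\<phi> (exp (- t)) - p (exp (- t))) * F t\<bar>)"
          using bounded_int[OF \<phi>] bounded_int[OF p_cont] by (simp add: left_diff_distrib)
        show "integrable lborel (\<lambda>t. (\<epsilon> / C) * \<bar>F t\<bar>)" using F_int by auto
        fix t :: real
        show "\<bar>(\<phi> (exp (- t)) - p (exp (- t))) * F t\<bar> \<le> (\<epsilon> / C) * \<bar>F t\<bar>"
        proof (cases "0 < t")
          case True
          then have "\<bar>\<phi> (exp (- t)) - p (exp (- t))\<bar> < \<epsilon> / C" by (intro p) auto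
          then show ?thesis unfolding abs_mult by (intro mult_right_mono) auto
        qed (simp add: F_def)
      qed
      also have "\<dots> = (\<epsilon> / C) * (C - 1)" by (simp add: C_def)
      also have "\<dots> \<le> 0 + \<epsilon>" using C \<open>0 < \<epsilon>\<close> by (simp add: field_simps)
      finally show ?thesis .
    qed
    then have "\<bar>\<integral>t. \<phi> (exp (- t)) * F t \<partial>lborel\<bar> \<le> 0" by (rule field_le_epsilon)
    then show ?thesis by simp
  qed
  define g where "g = (\<lambda>s. sgn (f t) * f s)"
  have "(g \<longlongrightarrow> g t) (at_left t)" unfolding g_def by (intro tendsto_intros left t)
  moreover have "0 < g t" using \<open>f t \<noteq> 0\<close> by (simp add: g_def sgn_if)
  ultimately have "eventually (\<lambda>s. 0 < g s) (at_left t)" by (rule order_tendstoD(1))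
  then obtain b' where b': "b' < t" "\<And>s. b' < s \<Longrightarrow> s < t \<Longrightarrow> 0 < g s"
    using t by (auto simp: eventually_at_left)
  define b where "b = max b' 0"
  have b: "0 \<le> b" "b < t" "\<And>s. b < s \<Longrightarrow> s < t \<Longrightarrow> 0 < g s" using b' t by (auto simp: b_def)
  \<comment> \<open>Up to the sign of \<open>f t\<close>, a bump that is positive exactly for \<open>exp (- t) < y < exp (- b)\<close>.\<close>
  define \<phi> where "\<phi> = (\<lambda>y. sgn (f t) * max 0 ((y - exp (- t)) * (exp (- b) - y)))"
  have \<phi>: "continuous_on UNIV \<phi>" unfolding \<phi>_def by (intro continuous_intros)
  have pos: "0 < \<phi> (exp (- s)) * F s" if "b < s" "s < t" for s
  proof -
    have "0 < (exp (- s) - exp (- t)) * (exp (- b) - exp (- s))" using that by simp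
    then have "\<phi> (exp (- s)) * F s = (exp (- s) - exp (- t)) * (exp (- b) - exp (- s)) * exp (- (\<sigma> * s)) * g s"
      using that b(1) by (simp add: \<phi>_def F_def g_def)
    then show ?thesis using that b(3)[OF that] by simp
  qed
  have nonneg: "0 \<le> \<phi> (exp (- s)) * F s" for s
  proof (cases "b < s \<and> s < t")
    case False
    then have "(exp (- s) - exp (- t)) * (exp (- b) - exp (- s)) \<le> 0"
      using b(2) by (auto simp: mult_le_0_iff not_less)
    then show ?thesis by (simp add: \<phi>_def max_def)
  qed (use pos in \<open>auto intro: less_imp_le\<close>)
  have "AE s in lborel. \<phi> (exp (- s)) * F s = 0"
    using integral_nonneg_eq_0_iff_AE[OF bounded_int[OF \<phi>]] nonneg continuous[OF \<phi>] by simp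
  then have "AE s in lborel. \<not> (s \<in> {b<..<t})"
    by eventually_elim (use pos in fastforce)
  then have "emeasure lborel {s \<in> space lborel. s \<in> {b<..<t}} = 0"
    by (rule emeasure_eq_0_AE)
  moreover have "{s \<in> space lborel. s \<in> {b<..<t}} = {b<..<t}" by auto
  ultimately show False using b(2) by simp
qed

text \<open>
  Approximate \<open>t\<close> strictly from the left by the fractions \<open>(\<lceil>(n + 1) t\<rceil> - 1) / (n + 1)\<close>, which take
  countably many values; each approximation is measurable and left-continuity gives convergence.
\<close>
lemma left_continuous_imp_jointly_measurable:
  fixes F :: "real \<Rightarrow> real \<Rightarrow> real"
  assumes F: "\<And>t. F t \<in> borel_measurable borel"
    and left: "\<And>t x S. (\<And>n. S n < t) \<Longrightarrow> S \<longlonglongrightarrow> t \<Longrightarrow> (\<lambda>n::nat. F (S n) x) \<longlonglongrightarrow> F t x"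
  shows "(\<lambda>(t, x). F t x) \<in> borel_measurable (borel \<Otimes>\<^sub>M borel)"
proof (rule borel_measurable_LIMSEQ_real)
  define S where "S = (\<lambda>(n::nat) t::real. (of_int \<lceil>real (Suc n) * t\<rceil> - 1) / real (Suc n))"
  have S: "S n t < t" "t - 1 / real (Suc n) \<le> S n t" for n t
    unfolding S_def by (simp_all add: field_simps del: of_nat_Suc) linarith+
  have "(\<lambda>n. S n t) \<longlonglongrightarrow> t" for t
  proof (rule tendsto_sandwich[OF _ _ _ tendsto_const])
    show "\<forall>\<^sub>F n in sequentially. t - 1 / real (Suc n) \<le> S n t"
      "\<forall>\<^sub>F n in sequentially. S n t \<le> t"
      using S by (auto intro!: always_eventually less_imp_le simp del: of_nat_Suc)
    have "(\<lambda>n. t - 1 / real (Suc n)) \<longlonglongrightarrow> t - 0"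
      by (intro tendsto_intros LIMSEQ_Suc lim_1_over_n)
    then show "(\<lambda>n. t - 1 / real (Suc n)) \<longlonglongrightarrow> t" by simp
  qed
  then show "(\<lambda>n. case p of (t, x) \<Rightarrow> F (S n t) x) \<longlonglongrightarrow> (case p of (t, x) \<Rightarrow> F t x)" for p
    using left S by (cases p) auto
  fix n :: nat
  have *: "(\<lambda>p. F ((of_int i - 1) / real (Suc n)) (snd p)) \<in> borel_measurable (borel \<Otimes>\<^sub>M borel)" for i
    using F by (rule measurable_compose[OF measurable_snd])
  show "(\<lambda>(t, x). F (S n t) x) \<in> borel_measurable (borel \<Otimes>\<^sub>M borel)"
    using measurable_compose_countable[OF *, of "\<lambda>p. \<lceil>real (Suc n) * fst p\<rceil>"]
    by (simp add: S_def case_prod_beta del: of_nat_Suc)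
qed

lemma nn_integral_exp_tail:
  fixes a c :: real
  assumes "0 < a" "0 \<le> c"
  shows "(\<integral>\<^sup>+x. ennreal (indicator {0<..} x * exp (- (a * x))) * indicator {c..} x \<partial>lborel) = ennreal (exp (- (a * c)) / a)"
proof -
  have "(\<integral>\<^sup>+x. ennreal (indicator {0<..} x * exp (- (a * x))) * indicator {c..} x \<partial>lborel) =
      (\<integral>\<^sup>+x. ennreal (exp (- (a * x))) * indicator {c..} x \<partial>lborel)"
    by (rule nn_integral_cong_AE, use AE_lborel_singleton[of "0::real"] in eventually_elim)
      (use assms in \<open>auto split: split_indicator\<close>)
  also have "\<dots> = ennreal (exp (- (a * c)) / a)"
    using has_integral_exp_minus_to_infinity[OF assms(1), of c]
    by (intro nn_integral_has_integral_lebesgue') auto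
  finally show ?thesis .
qed

lemma has_bochner_integral_exp_half_line:
  fixes a :: real
  assumes "0 < a"
  shows "has_bochner_integral lborel (\<lambda>x. indicator {0<..} x * exp (- (a * x))) (1 / a)"
proof (rule has_bochner_integral_nn_integral)
  have "(\<integral>\<^sup>+x. ennreal (indicator {0<..} x * exp (- (a * x))) \<partial>lborel) =
      (\<integral>\<^sup>+x. ennreal (indicator {0<..} x * exp (- (a * x))) * indicator {0..} x \<partial>lborel)"
    by (intro nn_integral_cong) (auto split: split_indicator)
  then show "(\<integral>\<^sup>+x. ennreal (indicator {0<..} x * exp (- (a * x))) \<partial>lborel) = ennreal (1 / a)"
    using nn_integral_exp_tail[OF assms, of 0] by simp
qed (use assms in auto)

lemma nn_integral_exp_head:
  fixes s h :: real
  assumes "0 < s" "0 \<le> h"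
  shows "(\<integral>\<^sup>+t. ennreal (indicator {0<..} t * exp (- (s * t))) * indicator {..h} t \<partial>lborel) =
    ennreal ((1 - exp (- (s * h))) / s)"
proof -
  have "(\<integral>\<^sup>+t. ennreal (indicator {0<..} t * exp (- (s * t))) * indicator {..h} t \<partial>lborel) =
      (\<integral>\<^sup>+t. ennreal (exp (- (s * t))) * indicator {0..h} t \<partial>lborel)"
    by (rule nn_integral_cong_AE, use AE_lborel_singleton[of "0::real"] in eventually_elim)
      (use assms in \<open>auto split: split_indicator\<close>)
  also have "\<dots> = ennreal (- exp (- (s * h)) / s - (- exp (- (s * 0)) / s))"
    using assms
    by (intro nn_integral_has_integral_lebesgue' fundamental_theorem_of_calculus)
      (auto intro!: derivative_eq_intros simp: has_real_derivative_iff_has_vector_derivative[symmetric])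
  finally show ?thesis by (simp add: diff_divide_distrib)
qed

section \<open>First passage times of a nondecreasing process\<close>

text \<open>
  The two exchanges of integrals are, with \<open>A(t, x) = P(X(x) \<ge> t) = P(L(t) \<le> x)\<close>,
  \<open>E exp (- \<gamma> L(t)) = \<integral> \<gamma> exp (- \<gamma> x) A(t, x) dx\<close> and
  \<open>\<integral> exp (- s t) A(t, x) dt = (1 - exp (- x \<psi>(s))) / s\<close>. The function \<open>A\<close> is left-continuous in \<open>t\<close>,
  which yields both the left-continuity of the first integral and the joint measurability that
  Fubini's theorem requires.
\<close>
lemma (in prob_space) laplace_first_passage:
  fixes X L :: "real \<Rightarrow> 'a \<Rightarrow> real" and \<psi> :: "real \<Rightarrow> real" and \<gamma> :: real
  assumes X[measurable]: "\<And>x. 0 < x \<Longrightarrow> random_variable borel (X x)"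
    and L: "\<And>t. 0 < t \<Longrightarrow> random_variable borel (L t)"
    and L_nonneg: "\<And>t \<omega>. 0 \<le> L t \<omega>"
    and X_nonneg: "\<And>x. 0 < x \<Longrightarrow> AE \<omega> in M. 0 \<le> X x \<omega>"
    and passage: "\<And>t x. 0 < t \<Longrightarrow> 0 < x \<Longrightarrow> AE \<omega> in M. L t \<omega> \<le> x \<longleftrightarrow> t \<le> X x \<omega>"
    and X_laplace: "\<And>x s. 0 < x \<Longrightarrow> 0 < s \<Longrightarrow> expectation (\<lambda>\<omega>. exp (- s * X x \<omega>)) = exp (- x * \<psi> s)"
    and \<psi>: "\<And>s. 0 < s \<Longrightarrow> 0 \<le> \<psi> s"
    and \<gamma>: "0 < \<gamma>"
  shows "\<And>t. 0 < t \<Longrightarrow> (laplace_process M L \<gamma> \<longlongrightarrow> laplace_process M L \<gamma> t) (at_left t)"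
    and "\<And>s. 0 < s \<Longrightarrow> has_bochner_integral lborel
      (\<lambda>t. indicator {0<..} t * (exp (- (s * t)) * laplace_process M L \<gamma> t)) (\<psi> s / (\<gamma> + \<psi> s) / s)"
proof -
  define A where "A = (\<lambda>t x. prob {\<omega> \<in> space M. t \<le> X x \<omega>})"
  define e where "e = (\<lambda>x. indicator {0<..} x * exp (- (\<gamma> * x)) :: real)"
  define K where "K = (\<lambda>t x. \<gamma> * (e x * A t x))"
  have A_eq: "A t x = prob {\<omega> \<in> space M. L t \<omega> \<le> x}" if "0 < t" "0 < x" for t x
    unfolding A_def using passage[OF that] X[OF that(2)] L[OF that(1)]
    by (intro finite_measure_eq_AE) auto
  have A_eq_1: "A t x = 1" if "t \<le> 0" "0 < x" for t x
    unfolding A_def using X_nonneg[OF that(2)] that X[OF that(2)]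
    by (subst prob_Collect_eq_1) (auto intro: order_trans)
  have A_bounds: "0 \<le> A t x" "A t x \<le> 1" for t x by (auto simp: A_def)
  have K_meas[measurable]: "K t \<in> borel_measurable borel" for t
  proof (cases "0 < t")
    case True
    note L[OF True, measurable]
    have "mono (\<lambda>x. prob {\<omega> \<in> space M. L t \<omega> \<le> x})"
      by (intro monoI finite_measure_mono) auto
    then have [measurable]: "(\<lambda>x. prob {\<omega> \<in> space M. L t \<omega> \<le> x}) \<in> borel_measurable borel"
      by (rule borel_measurable_mono)
    have "K t = (\<lambda>x. \<gamma> * (e x * prob {\<omega> \<in> space M. L t \<omega> \<le> x}))"
      using A_eq[OF True] by (auto simp: K_def e_def split: split_indicator)
    also have "\<dots> \<in> borel_measurable borel" unfolding e_def by measurable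
    finally show ?thesis .
  next
    case False
    then have "K t = (\<lambda>x. \<gamma> * e x)"
      using A_eq_1[of t] by (auto simp: K_def e_def split: split_indicator)
    also have "\<dots> \<in> borel_measurable borel" unfolding e_def by measurable
    finally show ?thesis .
  qed
  have e_int: "integrable lborel e"
    using has_bochner_integral_exp_half_line[OF \<gamma>] by (simp add: e_def[abs_def] has_bochner_integral_iff)
  have K_bound: "norm (K t x) \<le> \<gamma> * e x" for t x
    using A_bounds[of t x] \<gamma> by (auto simp: K_def e_def abs_mult mult_left_le split: split_indicator)
  have K_left: "(\<lambda>n. K (S n) x) \<longlonglongrightarrow> K t x" if S: "\<And>n. S n < t" "S \<longlonglongrightarrow> t" for S :: "nat \<Rightarrow> real" and t x
  proof (cases "0 < x")
    case True
    note X[OF True, measurable]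
    have A_int: "A t x = expectation (\<lambda>\<omega>. indicator {t..} (X x \<omega>))" for t
    proof -
      have "expectation (\<lambda>\<omega>. indicator {t..} (X x \<omega>) :: real) =
          expectation (indicator {\<omega> \<in> space M. t \<le> X x \<omega>})"
        by (intro Bochner_Integration.integral_cong) (auto split: split_indicator)
      then show ?thesis by (simp add: A_def)
    qed
    have "(\<lambda>n. expectation (\<lambda>\<omega>. indicator {S n..} (X x \<omega>))) \<longlonglongrightarrow>
        expectation (\<lambda>\<omega>. indicator {t..} (X x \<omega>) :: real)"
    proof (rule integral_dominated_convergence[where w = "\<lambda>_. 1"])
      have "(\<lambda>n. indicator {S n..} y) \<longlonglongrightarrow> (indicator {t..} y :: real)" for y
      proof (cases "t \<le> y")
        case True
        then have "S n \<le> y" for n using S(1)[of n] by simp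
        with True show ?thesis by simp
      next
        case False
        then have "eventually (\<lambda>n. y < S n) sequentially"
          using S(2) by (intro order_tendstoD(1)) auto
        then have "eventually (\<lambda>n. indicator {S n..} y = (indicator {t..} y :: real)) sequentially"
          using False by (auto elim!: eventually_mono)
        then show ?thesis by (rule tendsto_eventually)
      qed
      then show "AE \<omega> in M. (\<lambda>n. indicator {S n..} (X x \<omega>)) \<longlonglongrightarrow> (indicator {t..} (X x \<omega>) :: real)"
        by simp
    qed auto
    then show ?thesis unfolding K_def A_int by (intro tendsto_intros)
  qed (simp add: K_def e_def)
  have joint[measurable]: "(\<lambda>(t, x). K t x) \<in> borel_measurable (borel \<Otimes>\<^sub>M borel)"
    using K_meas K_left by (rule left_continuous_imp_jointly_measurable)
  have K_nonneg: "0 \<le> K t x" for t x using A_bounds \<gamma> by (simp add: K_def e_def)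
  define l where "l = (\<lambda>t. \<integral>x. K t x \<partial>lborel)"
  have K_int: "integrable lborel (K t)" for t
    using K_bound by (intro Bochner_Integration.integrable_bound[OF integrable_mult_right[OF e_int, of \<gamma>]])
      (auto intro: order_trans[OF _ abs_ge_self])
  have l_nn: "ennreal (l t) = (\<integral>\<^sup>+x. ennreal (K t x) \<partial>lborel)" for t
    unfolding l_def using K_int K_nonneg by (intro nn_integral_eq_integral[symmetric]) auto
  \<comment> \<open>First exchange: \<open>exp (- \<gamma> L)\<close> is the integral of \<open>\<gamma> exp (- \<gamma> x)\<close> over \<open>x \<ge> L\<close>.\<close>
  have l_eq: "laplace_process M L \<gamma> t = l t" if "0 < t" for t
  proof -
    note L[OF that, measurable]
    interpret pair_sigma_finite M lborel ..
    have "ennreal (laplace_process M L \<gamma> t) = (\<integral>\<^sup>+\<omega>. ennreal (exp (- \<gamma> * L t \<omega>)) \<partial>M)"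
      unfolding laplace_process_def using \<gamma> L_nonneg
      by (intro nn_integral_eq_integral[symmetric] integrable_const_bound[where B = 1]) auto
    also have "\<dots> = (\<integral>\<^sup>+\<omega>. (\<integral>\<^sup>+x. ennreal (\<gamma> * e x) * indicator {L t \<omega>..} x \<partial>lborel) \<partial>M)"
    proof (rule nn_integral_cong)
      fix \<omega>
      have "(\<integral>\<^sup>+x. ennreal (\<gamma> * e x) * indicator {L t \<omega>..} x \<partial>lborel) =
          (\<integral>\<^sup>+x. ennreal \<gamma> * (ennreal (e x) * indicator {L t \<omega>..} x) \<partial>lborel)"
        using \<gamma> by (intro nn_integral_cong) (simp add: ennreal_mult' mult.assoc)
      also have "\<dots> = ennreal \<gamma> * (\<integral>\<^sup>+x. ennreal (e x) * indicator {L t \<omega>..} x \<partial>lborel)"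
        unfolding e_def by (intro nn_integral_cmult) measurable
      also have "\<dots> = ennreal (exp (- \<gamma> * L t \<omega>))"
        using \<gamma> nn_integral_exp_tail[OF \<gamma> L_nonneg] by (simp add: e_def flip: ennreal_mult')
      finally show "ennreal (exp (- \<gamma> * L t \<omega>)) = (\<integral>\<^sup>+x. ennreal (\<gamma> * e x) * indicator {L t \<omega>..} x \<partial>lborel)"
        by simp
    qed
    also have "\<dots> = (\<integral>\<^sup>+\<omega>. (\<integral>\<^sup>+x. ennreal (\<gamma> * e x) * indicator {\<omega>' \<in> space M. L t \<omega>' \<le> x} \<omega> \<partial>lborel) \<partial>M)"
      by (intro nn_integral_cong) (auto split: split_indicator)
    also have "\<dots> = (\<integral>\<^sup>+x. (\<integral>\<^sup>+\<omega>. ennreal (\<gamma> * e x) * indicator {\<omega>' \<in> space M. L t \<omega>' \<le> x} \<omega> \<partial>M) \<partial>lborel)"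
      unfolding e_def by (intro Fubini'[symmetric]) measurable
    also have "\<dots> = (\<integral>\<^sup>+x. ennreal (K t x) \<partial>lborel)"
    proof (rule nn_integral_cong)
      fix x :: real
      have "(\<integral>\<^sup>+\<omega>. ennreal (\<gamma> * e x) * indicator {\<omega>' \<in> space M. L t \<omega>' \<le> x} \<omega> \<partial>M) =
          ennreal (\<gamma> * e x) * ennreal (prob {\<omega>' \<in> space M. L t \<omega>' \<le> x})"
        by (subst nn_integral_cmult_indicator) (auto simp: emeasure_eq_measure)
      also have "\<dots> = ennreal (K t x)"
        using A_eq[OF that, of x] \<gamma>
        by (cases "0 < x") (auto simp: K_def e_def mult.assoc simp flip: ennreal_mult)
      finally show "(\<integral>\<^sup>+\<omega>. ennreal (\<gamma> * e x) * indicator {\<omega>' \<in> space M. L t \<omega>' \<le> x} \<omega> \<partial>M) = ennreal (K t x)" .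
    qed
    also have "\<dots> = ennreal (l t)" by (rule l_nn[symmetric])
    finally show ?thesis
      using K_nonneg by (subst (asm) ennreal_inj) (auto simp: laplace_process_def l_def)
  qed
  have l_left: "(l \<longlongrightarrow> l t) (at_left t)" for t
  proof (rule tendsto_at_left_sequentially[of "t - 1"])
    fix S :: "nat \<Rightarrow> real"
    assume S: "\<And>n. S n < t" "S \<longlonglongrightarrow> t"
    show "(\<lambda>n. l (S n)) \<longlonglongrightarrow> l t"
      unfolding l_def
      using K_left[OF S] K_bound e_int
      by (intro integral_dominated_convergence[where w = "\<lambda>x. \<gamma> * e x"]) auto
  qed simp
  show "(laplace_process M L \<gamma> \<longlongrightarrow> laplace_process M L \<gamma> t) (at_left t)" if "0 < t" for t
  proof -
    have "eventually (\<lambda>s. l s = laplace_process M L \<gamma> s) (at_left t)"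
      using that by (auto simp: eventually_at_left l_eq intro!: exI[of _ 0])
    then show ?thesis
      using Lim_transform_eventually[OF l_left[of t]] l_eq[OF that] by simp
  qed
  show "has_bochner_integral lborel
      (\<lambda>t. indicator {0<..} t * (exp (- (s * t)) * laplace_process M L \<gamma> t)) (\<psi> s / (\<gamma> + \<psi> s) / s)"
    if s: "0 < s" for s
  proof -
    define d where "d = (\<lambda>t. indicator {0<..} t * exp (- (s * t)) :: real)"
    have [measurable]: "d \<in> borel_measurable borel" unfolding d_def by measurable
    have [measurable]: "l \<in> borel_measurable borel"
      unfolding l_def by measurable
    have d_nonneg: "0 \<le> d t" for t by (simp add: d_def)
    have e_nonneg: "0 \<le> e x" for x by (simp add: e_def)
    have [measurable]: "e \<in> borel_measurable borel" unfolding e_def by measurable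
    \<comment> \<open>Second exchange: for fixed \<open>x\<close> the integral over \<open>t \<le> X x\<close> is explicit, and its expectation
      is the Laplace transform of \<open>X x\<close>.\<close>
    have inner: "(\<integral>\<^sup>+t. ennreal (d t * K t x) \<partial>lborel) = ennreal (\<gamma> * (e x * ((1 - exp (- (x * \<psi> s))) / s)))" for x
    proof (cases "0 < x")
      case True
      note X[OF True, measurable]
      interpret pair_sigma_finite lborel M ..
      have "(\<integral>\<^sup>+t. ennreal (d t * K t x) \<partial>lborel) =
          (\<integral>\<^sup>+t. ennreal (\<gamma> * e x) * (ennreal (d t) * ennreal (A t x)) \<partial>lborel)"
        using \<gamma> d_nonneg e_nonneg A_bounds
        by (intro nn_integral_cong) (simp add: K_def mult_ac flip: ennreal_mult)
      also have "\<dots> = (\<integral>\<^sup>+t. (\<integral>\<^sup>+\<omega>. ennreal (\<gamma> * e x) * (ennreal (d t) * indicator {..X x \<omega>} t) \<partial>M) \<partial>lborel)"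
      proof (rule nn_integral_cong)
        fix t :: real
        have "(\<integral>\<^sup>+\<omega>. ennreal (\<gamma> * e x) * (ennreal (d t) * indicator {..X x \<omega>} t) \<partial>M) =
            (\<integral>\<^sup>+\<omega>. (ennreal (\<gamma> * e x) * ennreal (d t)) * indicator {\<omega> \<in> space M. t \<le> X x \<omega>} \<omega> \<partial>M)"
          by (intro nn_integral_cong) (auto simp: mult.assoc split: split_indicator)
        also have "\<dots> = ennreal (\<gamma> * e x) * ennreal (d t) * ennreal (A t x)"
          by (subst nn_integral_cmult_indicator) (auto simp: A_def emeasure_eq_measure)
        finally show "ennreal (\<gamma> * e x) * (ennreal (d t) * ennreal (A t x)) =
            (\<integral>\<^sup>+\<omega>. ennreal (\<gamma> * e x) * (ennreal (d t) * indicator {..X x \<omega>} t) \<partial>M)"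
          by (simp add: mult.assoc)
      qed
      also have "\<dots> = (\<integral>\<^sup>+\<omega>. (\<integral>\<^sup>+t. ennreal (\<gamma> * e x) * (ennreal (d t) * indicator {..X x \<omega>} t) \<partial>lborel) \<partial>M)"
        unfolding atMost_iff indicator_def by (intro Fubini'[symmetric]) measurable
      also have "\<dots> = (\<integral>\<^sup>+\<omega>. ennreal (\<gamma> * e x * ((1 - exp (- (s * X x \<omega>))) / s)) \<partial>M)"
      proof (rule nn_integral_cong_AE, use X_nonneg[OF True] in eventually_elim)
        case (elim \<omega>)
        have "(\<integral>\<^sup>+t. ennreal (\<gamma> * e x) * (ennreal (d t) * indicator {..X x \<omega>} t) \<partial>lborel) =
            ennreal (\<gamma> * e x) * (\<integral>\<^sup>+t. ennreal (d t) * indicator {..X x \<omega>} t \<partial>lborel)"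
          by (intro nn_integral_cmult) measurable
        also have "(\<integral>\<^sup>+t. ennreal (d t) * indicator {..X x \<omega>} t \<partial>lborel) = ennreal ((1 - exp (- (s * X x \<omega>))) / s)"
          using nn_integral_exp_head[OF s elim] by (simp add: d_def)
        finally show ?case
          using \<gamma> e_nonneg[of x] by (simp add: ennreal_mult'[symmetric])
      qed
      also have "\<dots> = ennreal (expectation (\<lambda>\<omega>. \<gamma> * e x * ((1 - exp (- (s * X x \<omega>))) / s)))"
      proof (rule nn_integral_eq_integral)
        have "AE \<omega> in M. norm (exp (- (s * X x \<omega>))) \<le> 1"
          using X_nonneg[OF True] by eventually_elim (use s in simp)
        then have "integrable M (\<lambda>\<omega>. exp (- (s * X x \<omega>)))"
          by (intro integrable_const_bound[where B = 1]) auto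
        then show "integrable M (\<lambda>\<omega>. \<gamma> * e x * ((1 - exp (- (s * X x \<omega>))) / s))" by auto
        show "AE \<omega> in M. 0 \<le> \<gamma> * e x * ((1 - exp (- (s * X x \<omega>))) / s)"
          using X_nonneg[OF True] by eventually_elim (use s \<gamma> e_nonneg[of x] in auto)
      qed
      also have "expectation (\<lambda>\<omega>. \<gamma> * e x * ((1 - exp (- (s * X x \<omega>))) / s)) =
          \<gamma> * (e x * ((1 - exp (- (x * \<psi> s))) / s))"
      proof -
        have "AE \<omega> in M. norm (exp (- (s * X x \<omega>))) \<le> 1"
          using X_nonneg[OF True] by eventually_elim (use s in simp)
        then have "integrable M (\<lambda>\<omega>. exp (- (s * X x \<omega>)))"
          by (intro integrable_const_bound[where B = 1]) auto
        then show ?thesis using X_laplace[OF True s] by (simp add: prob_space)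
      qed
      finally show ?thesis .
    qed (simp add: K_def e_def)
    have "(\<integral>\<^sup>+t. ennreal (d t * l t) \<partial>lborel) = (\<integral>\<^sup>+t. (\<integral>\<^sup>+x. ennreal (d t * K t x) \<partial>lborel) \<partial>lborel)"
    proof (rule nn_integral_cong)
      fix t :: real
      have "(\<integral>\<^sup>+x. ennreal (d t * K t x) \<partial>lborel) = (\<integral>\<^sup>+x. ennreal (d t) * ennreal (K t x) \<partial>lborel)"
        using d_nonneg by (simp add: ennreal_mult')
      also have "\<dots> = ennreal (d t) * ennreal (l t)"
        by (subst nn_integral_cmult) (auto simp: l_nn)
      finally show "ennreal (d t * l t) = (\<integral>\<^sup>+x. ennreal (d t * K t x) \<partial>lborel)"
        using d_nonneg by (simp add: ennreal_mult')
    qed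
    also have "\<dots> = (\<integral>\<^sup>+x. (\<integral>\<^sup>+t. ennreal (d t * K t x) \<partial>lborel) \<partial>lborel)"
    proof -
      have "(\<lambda>p. ennreal (d (fst p) * (case p of (t, x) \<Rightarrow> K t x))) \<in> borel_measurable (borel \<Otimes>\<^sub>M borel)"
        by measurable
      then show ?thesis by (intro lborel_pair.Fubini'[symmetric]) (simp add: case_prod_beta cong: measurable_cong_sets)
    qed
    also have "\<dots> = (\<integral>\<^sup>+x. ennreal (\<gamma> * (e x * ((1 - exp (- (x * \<psi> s))) / s))) \<partial>lborel)"
      by (simp only: inner)
    also have "\<dots> = ennreal (\<psi> s / (\<gamma> + \<psi> s) / s)"
    proof -
      have pos: "0 < \<gamma> + \<psi> s" using \<gamma> \<psi>[OF s] by simp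
      have "has_bochner_integral lborel
          (\<lambda>x. \<gamma> / s * (indicator {0<..} x * exp (- (\<gamma> * x)) - indicator {0<..} x * exp (- ((\<gamma> + \<psi> s) * x))))
          (\<gamma> / s * (1 / \<gamma> - 1 / (\<gamma> + \<psi> s)))"
        by (intro has_bochner_integral_mult_right has_bochner_integral_diff
            has_bochner_integral_exp_half_line \<gamma> pos)
      moreover have "(\<lambda>x. \<gamma> / s * (indicator {0<..} x * exp (- (\<gamma> * x)) - indicator {0<..} x * exp (- ((\<gamma> + \<psi> s) * x))))
          = (\<lambda>x. \<gamma> * (e x * ((1 - exp (- (x * \<psi> s))) / s)))"
      proof
        fix x :: real
        have "exp (- ((\<gamma> + \<psi> s) * x)) = exp (- (\<gamma> * x)) * exp (- (x * \<psi> s))"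
          by (simp add: algebra_simps flip: exp_add)
        then show "\<gamma> / s * (indicator {0<..} x * exp (- (\<gamma> * x)) - indicator {0<..} x * exp (- ((\<gamma> + \<psi> s) * x)))
          = \<gamma> * (e x * ((1 - exp (- (x * \<psi> s))) / s))"
          using s by (simp add: e_def field_simps)
      qed
      moreover have "\<gamma> / s * (1 / \<gamma> - 1 / (\<gamma> + \<psi> s)) = \<psi> s / (\<gamma> + \<psi> s) / s"
        using pos s \<gamma> by (simp add: diff_frac_eq)
      ultimately have *: "has_bochner_integral lborel (\<lambda>x. \<gamma> * (e x * ((1 - exp (- (x * \<psi> s))) / s))) (\<psi> s / (\<gamma> + \<psi> s) / s)"
        by simp
      have "0 \<le> \<gamma> * (e x * ((1 - exp (- (x * \<psi> s))) / s))" for x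
        using \<gamma> s \<psi>[OF s] by (cases "0 < x") (auto simp: e_def)
      with * show ?thesis
        by (auto simp: has_bochner_integral_iff nn_integral_eq_integral)
    qed
    finally have "has_bochner_integral lborel (\<lambda>t. d t * l t) (\<psi> s / (\<gamma> + \<psi> s) / s)"
      using \<gamma> s \<psi>[OF s] d_nonneg K_nonneg
      by (intro has_bochner_integral_nn_integral) (auto simp: l_def)
    moreover have "(\<lambda>t. d t * l t) = (\<lambda>t. indicator {0<..} t * (exp (- (s * t)) * laplace_process M L \<gamma> t))"
      by (auto simp: d_def l_eq split: split_indicator)
    ultimately show ?thesis by simp
  qed
qed

section \<open>The inverse process of the two subordinators\<close>

text \<open>
  If the infimum is at most \<open>x\<close>, the level is reached at every time after \<open>x\<close>, and right-continuity
  carries this to \<open>x\<close> itself.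
\<close>
lemma first_passage_le_iff:
  fixes h :: "real \<Rightarrow> real"
  assumes mono: "mono_on {0..} h" and cont: "continuous (at_right x) h"
    and hit: "\<exists>s>0. t \<le> h s" and x: "0 < x"
  shows "Inf {s. 0 < s \<and> t \<le> h s} \<le> x \<longleftrightarrow> t \<le> h x"
proof
  let ?S = "{s. 0 < s \<and> t \<le> h s}"
  have bdd: "bdd_below ?S" by (rule bdd_belowI[of _ 0]) auto
  show "Inf ?S \<le> x" if "t \<le> h x" using that x bdd by (intro cInf_lower) auto
  assume le: "Inf ?S \<le> x"
  have above: "t \<le> h y" if "x < y" for y
  proof -
    have "Inf ?S < y" using le that by simp
    then obtain s where "0 < s" "t \<le> h s" "s < y" using hit bdd by (subst (asm) cInf_less_iff) auto
    then show ?thesis using mono_onD[OF mono, of s y] by force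
  qed
  have "(h \<longlongrightarrow> h x) (at_right x)" using cont by (simp add: continuous_within)
  moreover have "eventually (\<lambda>y. t \<le> h y) (at_right x)"
    using above by (auto simp: eventually_at_right_field intro: gt_ex)
  ultimately show "t \<le> h x" by (rule tendsto_lowerbound) simp
qed

lemma (in prob_space) independent_processes_imp_indep_var:
  assumes "independent_processes M X Y" "0 \<le> s" "0 \<le> t"
  shows "indep_var borel (X s) borel (Y t)"
proof -
  have "indep_var borel ((\<lambda>f. f s) \<circ> (\<lambda>\<omega>. \<lambda>t\<in>{0..}. X t \<omega>)) borel ((\<lambda>f. f t) \<circ> (\<lambda>\<omega>. \<lambda>t\<in>{0..}. Y t \<omega>))"
    using assms(1)[unfolded independent_processes_def]
    by (rule indep_var_compose) (use assms in \<open>auto intro!: measurable_component_singleton\<close>)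
  then show ?thesis using assms by (simp add: comp_def)
qed

text \<open>
  Collects what the order-one case \<open>H t = t\<close> and the genuine stable case have in common.
\<close>
lemma (in prob_space) stable_subordinator_properties:
  assumes H: "stable_subordinator M \<beta> H"
  shows "\<And>t. 0 \<le> t \<Longrightarrow> random_variable borel (H t)"
    and "AE \<omega> in M. mono_on {0..} (\<lambda>t. H t \<omega>) \<and> (\<forall>t\<ge>0. continuous (at_right t) (\<lambda>s. H s \<omega>)) \<and> H 0 \<omega> = 0"
    and "\<And>t s. 0 \<le> t \<Longrightarrow> 0 < s \<Longrightarrow> expectation (\<lambda>\<omega>. exp (- s * H t \<omega>)) = exp (- t * s powr \<beta>)"
proof -
  have "(\<forall>t\<ge>0. random_variable borel (H t)) \<and>
    (AE \<omega> in M. mono_on {0..} (\<lambda>t. H t \<omega>) \<and> (\<forall>t\<ge>0. continuous (at_right t) (\<lambda>s. H s \<omega>)) \<and> H 0 \<omega> = 0) \<and>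
    (\<forall>t\<ge>0. \<forall>s>0. expectation (\<lambda>\<omega>. exp (- s * H t \<omega>)) = exp (- t * s powr \<beta>))"
  proof (cases "\<beta> = 1")
    case True
    then have H_eq: "H t \<omega> = t" if "0 \<le> t" "\<omega> \<in> space M" for t \<omega>
      using H that by (simp add: stable_subordinator_def)
    have "random_variable borel (H t)" if "0 \<le> t" for t
      using H_eq[OF that] by (subst measurable_cong[where g = "\<lambda>_. t"]) auto
    moreover have "AE \<omega> in M. mono_on {0..} (\<lambda>t. H t \<omega>) \<and> (\<forall>t\<ge>0. continuous (at_right t) (\<lambda>s. H s \<omega>)) \<and> H 0 \<omega> = 0"
    proof (rule AE_I2)
      fix \<omega> assume \<omega>: "\<omega> \<in> space M"
      have "continuous (at_right t) (\<lambda>s. H s \<omega>)" if "0 \<le> t" for t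
      proof -
        have "\<forall>\<^sub>F s in at_right t. s = H s \<omega>"
          using that H_eq[OF _ \<omega>] by (auto simp: eventually_at_filter)
        then have "((\<lambda>s. H s \<omega>) \<longlongrightarrow> t) (at_right t)"
          by (rule Lim_transform_eventually[OF tendsto_ident_at])
        then show ?thesis using H_eq[OF that \<omega>] by (simp add: continuous_within)
      qed
      then show "mono_on {0..} (\<lambda>t. H t \<omega>) \<and> (\<forall>t\<ge>0. continuous (at_right t) (\<lambda>s. H s \<omega>)) \<and> H 0 \<omega> = 0"
        using H_eq[OF _ \<omega>] by (auto simp: monotone_on_def)
    qed
    moreover have "expectation (\<lambda>\<omega>. exp (- s * H t \<omega>)) = exp (- t * s powr \<beta>)" if "0 \<le> t" "0 < s" for s t
    proof -
      have "expectation (\<lambda>\<omega>. exp (- s * H t \<omega>)) = expectation (\<lambda>\<omega>. exp (- s * t))"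
        using H_eq[OF that(1)] by (intro Bochner_Integration.integral_cong) auto
      then show ?thesis using that True by (simp add: prob_space mult.commute)
    qed
    ultimately show ?thesis by blast
  next
    case False
    with H have H': "levy_process M H" "AE \<omega> in M. mono_on {0..} (\<lambda>t. H t \<omega>)"
      "\<forall>t\<ge>0. \<forall>s>0. expectation (\<lambda>\<omega>. exp (- s * H t \<omega>)) = exp (- t * s powr \<beta>)"
      by (simp_all add: stable_subordinator_def)
    from H'(1) have L: "\<forall>t\<ge>0. random_variable borel (H t)" "AE \<omega> in M. H 0 \<omega> = 0"
      "AE \<omega> in M. (\<forall>t\<ge>0. continuous (at_right t) (\<lambda>s. H s \<omega>)) \<and>
         (\<forall>t>0. \<exists>l. ((\<lambda>s. H s \<omega>) \<longlongrightarrow> l) (at_left t))"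
      unfolding levy_process_def by blast+
    have "AE \<omega> in M. mono_on {0..} (\<lambda>t. H t \<omega>) \<and> (\<forall>t\<ge>0. continuous (at_right t) (\<lambda>s. H s \<omega>)) \<and> H 0 \<omega> = 0"
      using H'(2) L(2,3) by eventually_elim blast
    with L(1) H'(3) show ?thesis by blast
  qed
  then show "\<And>t. 0 \<le> t \<Longrightarrow> random_variable borel (H t)"
    and "AE \<omega> in M. mono_on {0..} (\<lambda>t. H t \<omega>) \<and> (\<forall>t\<ge>0. continuous (at_right t) (\<lambda>s. H s \<omega>)) \<and> H 0 \<omega> = 0"
    and "\<And>t s. 0 \<le> t \<Longrightarrow> 0 < s \<Longrightarrow> expectation (\<lambda>\<omega>. exp (- s * H t \<omega>)) = exp (- t * s powr \<beta>)"
    by blast+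
qed

lemma inverse_process_nonneg: "0 \<le> inverse_process \<nu> lam H1 H2 t \<omega>"
  by (auto simp: inverse_process_def Let_def intro!: cInf_greatest)

text \<open>
  The process \<open>clock\<close> below is the sum whose first passage times form the inverse process.
\<close>
locale subordinator_pair = prob_space M for M :: "'a measure" +
  fixes \<nu> lam :: real and H1 H2 :: "real \<Rightarrow> 'a \<Rightarrow> real"
  assumes \<nu>: "0 < \<nu>" and lam: "0 < lam"
    and H1: "stable_subordinator M (2 * \<nu>) H1"
    and H2: "stable_subordinator M \<nu> H2"
    and indep_H: "independent_processes M H1 H2"
begin

definition clock :: "real \<Rightarrow> 'a \<Rightarrow> real" where
  "clock x \<omega> = H1 x \<omega> + (2 * lam) powr (1 / \<nu>) * H2 x \<omega>"

definition clock_exponent :: "real \<Rightarrow> real" where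
  "clock_exponent s = s powr (2 * \<nu>) + 2 * lam * s powr \<nu>"

lemma clock_measurable: "0 \<le> x \<Longrightarrow> random_variable borel (clock x)"
  using stable_subordinator_properties(1)[OF H1] stable_subordinator_properties(1)[OF H2]
  unfolding clock_def[abs_def] by (intro borel_measurable_add borel_measurable_times) auto

lemma clock_paths:
  "AE \<omega> in M. mono_on {0..} (\<lambda>x. clock x \<omega>) \<and> (\<forall>x\<ge>0. continuous (at_right x) (\<lambda>x. clock x \<omega>))
    \<and> (\<forall>x\<ge>0. 0 \<le> clock x \<omega>)"
  using stable_subordinator_properties(2)[OF H1] stable_subordinator_properties(2)[OF H2]
proof eventually_elim
  case (elim \<omega>)
  then have m: "mono_on {0..} (\<lambda>x. H1 x \<omega>)" "mono_on {0..} (\<lambda>x. H2 x \<omega>)" by blast+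
  have "mono_on {0..} (\<lambda>x. clock x \<omega>)"
    unfolding clock_def using mono_onD[OF m(1)] mono_onD[OF m(2)]
    by (intro mono_onI add_mono mult_left_mono) auto
  moreover have "continuous (at_right x) (\<lambda>x. clock x \<omega>)" if "0 \<le> x" for x
    unfolding clock_def using elim that by (intro continuous_intros) auto
  moreover have "0 \<le> clock x \<omega>" if "0 \<le> x" for x
    using mono_onD[OF m(1), of 0 x] mono_onD[OF m(2), of 0 x] elim that by (simp add: clock_def)
  ultimately show ?case by blast
qed

text \<open>
  The weight \<open>(2\<lambda>)\<^bsup>1/\<nu>\<^esup>\<close> is raised to the power \<open>\<nu>\<close> by the second subordinator, which produces
  the coefficient \<open>2\<lambda>\<close>.
\<close>
lemma clock_laplace:
  assumes "0 \<le> x" "0 < s"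
  shows "expectation (\<lambda>\<omega>. exp (- s * clock x \<omega>)) = exp (- x * clock_exponent s)"
    and "integrable M (\<lambda>\<omega>. exp (- s * clock x \<omega>))"
proof -
  define a where "a = (2 * lam) powr (1 / \<nu>)"
  have a: "0 < a" "(a * s) powr \<nu> = 2 * lam * s powr \<nu>"
    using lam \<nu> assms by (simp_all add: a_def powr_mult powr_powr)
  note [measurable] = stable_subordinator_properties(1)[OF H1 assms(1)]
    stable_subordinator_properties(1)[OF H2 assms(1)] clock_measurable[OF assms(1)]
  have int: "integrable M (\<lambda>\<omega>. exp (- r * H x \<omega>))"
    if "0 < r" "stable_subordinator M \<beta> H" for r \<beta> H
  proof (rule integrable_const_bound[where B = 1])
    show "AE \<omega> in M. norm (exp (- r * H x \<omega>)) \<le> 1"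
      using stable_subordinator_properties(2)[OF that(2)]
    proof eventually_elim
      case (elim \<omega>)
      then have "0 \<le> H x \<omega>" using mono_onD[of "{0..}" "\<lambda>t. H t \<omega>" 0 x] assms(1) by auto
      then show ?case using that(1) by simp
    qed
    show "(\<lambda>\<omega>. exp (- r * H x \<omega>)) \<in> borel_measurable M"
      using stable_subordinator_properties(1)[OF that(2) assms(1), measurable] by measurable
  qed
  have split: "exp (- s * H1 x \<omega>) * exp (- (a * s) * H2 x \<omega>) = exp (- s * clock x \<omega>)" for \<omega>
    unfolding clock_def a_def[symmetric] by (simp add: algebra_simps flip: exp_add)
  have "indep_var borel (\<lambda>\<omega>. exp (- s * H1 x \<omega>)) borel (\<lambda>\<omega>. exp (- (a * s) * H2 x \<omega>))"
    using indep_var_compose[OF independent_processes_imp_indep_var[OF indep_H assms(1) assms(1)],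
        of "\<lambda>y. exp (- s * y)" borel "\<lambda>y. exp (- (a * s) * y)" borel]
    by (simp add: comp_def)
  then have "expectation (\<lambda>\<omega>. exp (- s * H1 x \<omega>) * exp (- (a * s) * H2 x \<omega>)) =
      expectation (\<lambda>\<omega>. exp (- s * H1 x \<omega>)) * expectation (\<lambda>\<omega>. exp (- (a * s) * H2 x \<omega>))"
    using a assms by (intro indep_var_lebesgue_integral int[OF _ H1] int[OF _ H2]) auto
  also have "\<dots> = exp (- x * s powr (2 * \<nu>)) * exp (- x * (a * s) powr \<nu>)"
    using stable_subordinator_properties(3)[OF H1 assms]
      stable_subordinator_properties(3)[OF H2 assms(1), of "a * s"] a(1) assms(2) by simp
  also have "\<dots> = exp (- x * clock_exponent s)"
    unfolding a(2) clock_exponent_def by (simp add: algebra_simps flip: exp_add)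
  finally show "expectation (\<lambda>\<omega>. exp (- s * clock x \<omega>)) = exp (- x * clock_exponent s)"
    unfolding split .
  show "integrable M (\<lambda>\<omega>. exp (- s * clock x \<omega>))"
  proof (rule integrable_const_bound[where B = 1])
    show "AE \<omega> in M. norm (exp (- s * clock x \<omega>)) \<le> 1"
      using clock_paths by eventually_elim (use assms in auto)
  qed simp
qed

lemma clock_exponent_nonneg: "0 < s \<Longrightarrow> 0 \<le> clock_exponent s"
  using lam by (simp add: clock_exponent_def)

text \<open>
  By Markov's inequality the probability of staying below \<open>t\<close> up to the time \<open>n\<close> is at most
  \<open>exp (t - n \<psi>(1))\<close>. This makes the set of passage times almost surely nonempty.
\<close>
lemma clock_unbounded: "AE \<omega> in M. \<exists>x>0. t \<le> clock x \<omega>"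
proof -
  define N where "N = {\<omega> \<in> space M. \<forall>n. clock (real (Suc n)) \<omega> < t}"
  have [measurable]: "random_variable borel (clock (real (Suc n)))" for n
    by (rule clock_measurable) simp
  have N[measurable]: "N \<in> sets M" unfolding N_def by measurable
  define \<psi> where "\<psi> = clock_exponent 1"
  have \<psi>: "0 < \<psi>" using lam by (simp add: \<psi>_def clock_exponent_def)
  have bound: "prob N \<le> exp t * exp (- \<psi>) ^ Suc n" for n
  proof -
    have "prob N = expectation (indicator N)" using N sets.sets_into_space[OF N] by (simp add: Int_absorb2)
    also have "\<dots> \<le> expectation (\<lambda>\<omega>. exp t * exp (- 1 * clock (real (Suc n)) \<omega>))"
    proof (rule integral_mono)
      show "integrable M (\<lambda>\<omega>. exp t * exp (- 1 * clock (real (Suc n)) \<omega>))"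
        by (intro integrable_mult_right clock_laplace) auto
      show "integrable M (indicator N :: _ \<Rightarrow> real)"
        by (intro integrable_real_indicator N) (simp add: emeasure_eq_measure)
      fix \<omega>
      have "1 \<le> exp t * exp (- 1 * clock (real (Suc n)) \<omega>)" if "\<omega> \<in> N"
        using that by (auto simp: N_def less_imp_le simp flip: exp_add)
      then show "indicator N \<omega> \<le> exp t * exp (- 1 * clock (real (Suc n)) \<omega>)"
        by (auto simp: indicator_def)
    qed
    also have "\<dots> = exp t * exp (- real (Suc n) * \<psi>)"
      using clock_laplace(1)[of "real (Suc n)" 1] by (simp add: \<psi>_def)
    also have "exp (- real (Suc n) * \<psi>) = exp (real (Suc n) * (- \<psi>))"
      by (simp only: mult_minus_left mult_minus_right)
    also have "\<dots> = exp (- \<psi>) ^ Suc n" by (rule exp_of_nat_mult)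
    finally show ?thesis .
  qed
  have "(\<lambda>n. exp t * exp (- \<psi>) ^ Suc n) \<longlonglongrightarrow> exp t * 0"
    using \<psi> by (intro tendsto_mult tendsto_const LIMSEQ_Suc LIMSEQ_realpow_zero) auto
  then have "prob N \<le> exp t * 0" by (rule LIMSEQ_le_const) (use bound in blast)
  then have "prob N = 0" using measure_nonneg[of M N] by simp
  then have "N \<in> null_sets M" using N by (auto simp: null_sets_def emeasure_eq_measure)
  then have "AE \<omega> in M. \<omega> \<notin> N" by (rule AE_not_in)
  then show ?thesis
    using AE_space
  proof eventually_elim
    case (elim \<omega>)
    then obtain n where "t \<le> clock (real (Suc n)) \<omega>" by (auto simp: N_def not_less)
    then show ?case by (intro exI[of _ "real (Suc n)"]) auto
  qed
qed

lemma inverse_process_le_iff: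
  assumes "0 < t" "0 < x"
  shows "AE \<omega> in M. inverse_process \<nu> lam H1 H2 t \<omega> \<le> x \<longleftrightarrow> t \<le> clock x \<omega>"
  using clock_paths clock_unbounded[of t]
proof eventually_elim
  case (elim \<omega>)
  then have "inverse_process \<nu> lam H1 H2 t \<omega> = Inf {s. 0 < s \<and> t \<le> clock s \<omega>}"
    using assms by (auto simp: inverse_process_def clock_def)
  moreover have "Inf {s. 0 < s \<and> t \<le> clock s \<omega>} \<le> x \<longleftrightarrow> t \<le> clock x \<omega>"
    using elim assms by (intro first_passage_le_iff) auto
  ultimately show ?case by simp
qed

lemma inverse_process_laplace:
  assumes "\<And>t. 0 < t \<Longrightarrow> random_variable borel (inverse_process \<nu> lam H1 H2 t)" and \<gamma>: "0 < \<gamma>"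
  shows "\<And>t. 0 < t \<Longrightarrow> (laplace_process M (inverse_process \<nu> lam H1 H2) \<gamma> \<longlongrightarrow>
      laplace_process M (inverse_process \<nu> lam H1 H2) \<gamma> t) (at_left t)"
    and "\<And>s. 0 < s \<Longrightarrow> has_bochner_integral lborel
      (\<lambda>t. indicator {0<..} t * (exp (- (s * t)) * laplace_process M (inverse_process \<nu> lam H1 H2) \<gamma> t))
      (clock_exponent s / (\<gamma> + clock_exponent s) / s)"
proof -
  have nonneg: "AE \<omega> in M. 0 \<le> clock x \<omega>" if "0 < x" for x
    using clock_paths by eventually_elim (use that in auto)
  note main = laplace_first_passage[of clock "inverse_process \<nu> lam H1 H2" clock_exponent \<gamma>,
      OF clock_measurable[OF less_imp_le] assms(1) inverse_process_nonneg nonneg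
        inverse_process_le_iff clock_laplace(1)[OF less_imp_le] clock_exponent_nonneg \<gamma>]
  show "\<And>t. 0 < t \<Longrightarrow> (laplace_process M (inverse_process \<nu> lam H1 H2) \<gamma> \<longlongrightarrow>
      laplace_process M (inverse_process \<nu> lam H1 H2) \<gamma> t) (at_left t)"
    by (rule main(1))
  show "\<And>s. 0 < s \<Longrightarrow> has_bochner_integral lborel
      (\<lambda>t. indicator {0<..} t * (exp (- (s * t)) * laplace_process M (inverse_process \<nu> lam H1 H2) \<gamma> t))
      (clock_exponent s / (\<gamma> + clock_exponent s) / s)"
    by (rule main(2))
qed

end

section \<open>Generating functions of counting processes under a random time\<close>

text \<open>
  Allowing the summand to depend on the sample point makes this serve both for generating functions
  and for evaluating a process at a discrete random time.
\<close>
lemma (in prob_space) expectation_split_nat_sums: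
  fixes g :: "nat \<Rightarrow> 'a \<Rightarrow> real"
  assumes K[measurable]: "random_variable (count_space UNIV) K"
    and g[measurable]: "\<And>n. random_variable borel (g n)"
    and bound: "\<And>n \<omega>. \<omega> \<in> space M \<Longrightarrow> \<bar>g n \<omega>\<bar> \<le> B"
  shows "(\<lambda>n. expectation (\<lambda>\<omega>. indicator {n} (K \<omega>) * g n \<omega>)) sums expectation (\<lambda>\<omega>. g (K \<omega>) \<omega>)"
proof -
  have K_ind[measurable]: "(\<lambda>\<omega>. indicator {n} (K \<omega>) :: real) \<in> borel_measurable M" for n
    by (rule measurable_compose[OF K]) simp
  define Y where "Y = (\<lambda>N \<omega>. \<Sum>n<N. indicator {n} (K \<omega>) * g n \<omega>)"
  have Y_eq: "Y N \<omega> = (if K \<omega> < N then g (K \<omega>) \<omega> else 0)" for N \<omega>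
    by (simp add: Y_def indicator_def if_distrib[of "\<lambda>x. x * _"] sum.delta' cong: if_cong)
  have "integrable M (\<lambda>\<omega>. indicator {n} (K \<omega>) * g n \<omega>)" for n
    using bound[of _ n] by (intro integrable_const_bound[where B = "\<bar>B\<bar>"])
      (auto simp: indicator_def abs_mult intro: order_trans[OF _ abs_ge_self])
  then have "expectation (Y N) = (\<Sum>n<N. expectation (\<lambda>\<omega>. indicator {n} (K \<omega>) * g n \<omega>))" for N
    unfolding Y_def by (intro Bochner_Integration.integral_sum)
  moreover have "(\<lambda>N. expectation (Y N)) \<longlonglongrightarrow> expectation (\<lambda>\<omega>. g (K \<omega>) \<omega>)"
  proof (rule integral_dominated_convergence[where w = "\<lambda>_. \<bar>B\<bar>"])
    show "(\<lambda>\<omega>. g (K \<omega>) \<omega>) \<in> borel_measurable M"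
      by (rule measurable_compose_countable[OF g K])
    show "Y N \<in> borel_measurable M" for N
      unfolding Y_def by (intro borel_measurable_sum borel_measurable_times K_ind g)
    have "(\<lambda>N. Y N \<omega>) \<longlonglongrightarrow> g (K \<omega>) \<omega>" for \<omega>
      by (rule tendsto_eventually, rule eventually_mono[OF eventually_gt_at_top[of "K \<omega>"]])
        (simp add: Y_eq)
    then show "AE \<omega> in M. (\<lambda>N. Y N \<omega>) \<longlonglongrightarrow> g (K \<omega>) \<omega>" by simp
    show "AE \<omega> in M. norm (Y N \<omega>) \<le> \<bar>B\<bar>" for N
    proof (rule AE_I2)
      fix \<omega> assume "\<omega> \<in> space M"
      then have "\<bar>g (K \<omega>) \<omega>\<bar> \<le> B" by (rule bound)
      moreover from this have "0 \<le> B" by (rule order_trans[OF abs_ge_zero])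
      ultimately show "norm (Y N \<omega>) \<le> \<bar>B\<bar>" by (simp add: Y_eq)
    qed
  qed simp
  ultimately show ?thesis by (simp add: sums_def)
qed

text \<open>
  Increments are real-valued in the hypotheses, so powers are taken with exponent \<open>nat \<lfloor>y\<rfloor>\<close>, a
  measurable function that agrees with the natural exponent on increments.
\<close>
lemma (in prob_space) indep_increments_pgf_mult:
  fixes N :: "real \<Rightarrow> 'a \<Rightarrow> nat" and u :: real
  assumes N: "counting_process M N" "AE \<omega> in M. N 0 \<omega> = 0"
    and incr: "independent_increments M (\<lambda>t \<omega>. real (N t \<omega>))"
      "stationary_increments M (\<lambda>t \<omega>. real (N t \<omega>))"
    and u: "\<bar>u\<bar> \<le> 1" and st: "0 \<le> s" "0 \<le> t"
  shows "expectation (\<lambda>\<omega>. u ^ N (s + t) \<omega>) = expectation (\<lambda>\<omega>. u ^ N s \<omega>) * expectation (\<lambda>\<omega>. u ^ N t \<omega>)"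
proof -
  have N_meas: "random_variable (count_space UNIV) (N t)" if "0 \<le> t" for t
    using N(1) that by (simp add: counting_process_def)
  have N_mono: "N s \<omega> \<le> N t \<omega>" if "0 \<le> s" "s \<le> t" "\<omega> \<in> space M" for s t \<omega>
    using N(1) that by (auto simp: counting_process_def monotone_on_def)
  note [measurable] = N_meas[OF st(1)] N_meas[OF st(2)] N_meas[OF order_refl] N_meas[OF add_nonneg_nonneg[OF st]]
  define pw where "pw = (\<lambda>y::real. u ^ nat \<lfloor>y\<rfloor>)"
  have pw_meas[measurable]: "pw \<in> borel_measurable borel" unfolding pw_def by measurable
  have pw_diff: "pw (real a - real b) = u ^ (a - b)" if "b \<le> a" for a b
  proof -
    have eq: "real a - real b = real (a - b)" by (rule of_nat_diff[symmetric]) (rule that)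
    show ?thesis by (simp only: pw_def eq floor_of_nat nat_int)
  qed
  have pw_bound: "norm (pw y) \<le> 1" for y using u by (simp add: pw_def power_abs power_le_one)
  define \<tau> where "\<tau> = (\<lambda>i::nat. if i = 0 then 0 else if i = 1 then s else s + t)"
  define D where "D = (\<lambda>i \<omega>. real (N (\<tau> (Suc i)) \<omega>) - real (N (\<tau> i) \<omega>))"
  have \<tau>: "mono_on {..2} \<tau>" "0 \<le> \<tau> 0" "0 \<le> \<tau> i" for i
    using st by (auto simp: monotone_on_def \<tau>_def)
  have D_meas[measurable]: "random_variable borel (D i)" for i
    unfolding D_def using N_meas[OF \<tau>(3), measurable] by measurable
  have "indep_vars (\<lambda>_. borel) D {..<2}"
    using incr(1)[unfolded independent_increments_def, THEN spec[of _ 2], THEN spec[of _ \<tau>]] \<tau>(1,2)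
    unfolding D_def by simp
  then have "indep_vars (\<lambda>_. borel) (\<lambda>i \<omega>. pw (D i \<omega>)) {..<2}"
    by (rule indep_vars_compose2) simp
  moreover have "integrable M (\<lambda>\<omega>. pw (D i \<omega>))" for i
    by (rule integrable_const_bound[where B = 1]) (simp_all add: pw_bound del: real_norm_def)
  ultimately have "expectation (\<lambda>\<omega>. \<Prod>i<2. pw (D i \<omega>)) = (\<Prod>i<2. expectation (\<lambda>\<omega>. pw (D i \<omega>)))"
    by (intro indep_vars_lebesgue_integral) simp_all
  then have prod: "expectation (\<lambda>\<omega>. pw (D 0 \<omega>) * pw (D 1 \<omega>)) =
      expectation (\<lambda>\<omega>. pw (D 0 \<omega>)) * expectation (\<lambda>\<omega>. pw (D 1 \<omega>))"
    by (simp add: numeral_2_eq_2)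
  have D0: "expectation (\<lambda>\<omega>. pw (D 0 \<omega>)) = expectation (\<lambda>\<omega>. u ^ N s \<omega>)"
  proof (rule integral_cong_AE)
    show "AE \<omega> in M. pw (D 0 \<omega>) = u ^ N s \<omega>"
      using N(2) by eventually_elim (simp add: D_def \<tau>_def pw_def)
  qed simp_all
  have D1: "expectation (\<lambda>\<omega>. pw (D 1 \<omega>)) = expectation (\<lambda>\<omega>. u ^ N t \<omega>)"
  proof -
    have "expectation (\<lambda>\<omega>. pw (D 1 \<omega>)) =
        (\<integral>y. pw y \<partial>distr M borel (\<lambda>\<omega>. real (N (s + t) \<omega>) - real (N s \<omega>)))"
      by (subst integral_distr) (auto simp: D_def \<tau>_def)
    also have "\<dots> = (\<integral>y. pw y \<partial>distr M borel (\<lambda>\<omega>. real (N t \<omega>) - real (N 0 \<omega>)))"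
      using incr(2) st by (simp add: stationary_increments_def)
    also have "\<dots> = expectation (\<lambda>\<omega>. pw (real (N t \<omega>) - real (N 0 \<omega>)))"
      by (subst integral_distr) auto
    also have "\<dots> = expectation (\<lambda>\<omega>. u ^ N t \<omega>)"
    proof (rule integral_cong_AE)
      show "AE \<omega> in M. pw (real (N t \<omega>) - real (N 0 \<omega>)) = u ^ N t \<omega>"
        using N(2) by eventually_elim (simp add: pw_def)
    qed simp_all
    finally show ?thesis .
  qed
  have "expectation (\<lambda>\<omega>. u ^ N (s + t) \<omega>) = expectation (\<lambda>\<omega>. pw (D 0 \<omega>) * pw (D 1 \<omega>))"
  proof (rule integral_cong_AE)
    show "AE \<omega> in M. u ^ N (s + t) \<omega> = pw (D 0 \<omega>) * pw (D 1 \<omega>)"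
      using N(2) AE_space
    proof eventually_elim
      case (elim \<omega>)
      have "N s \<omega> \<le> N (s + t) \<omega>" using st elim by (intro N_mono) auto
      then have "u ^ N (s + t) \<omega> = u ^ N s \<omega> * u ^ (N (s + t) \<omega> - N s \<omega>)"
        by (simp flip: power_add)
      moreover have "pw (D 0 \<omega>) = u ^ N s \<omega>"
        using elim by (simp add: D_def \<tau>_def pw_def)
      moreover have "pw (D 1 \<omega>) = u ^ (N (s + t) \<omega> - N s \<omega>)"
        using pw_diff[OF \<open>N s \<omega> \<le> N (s + t) \<omega>\<close>] by (simp add: D_def \<tau>_def)
      ultimately show ?case by simp
    qed
  qed simp_all
  with prod D0 D1 show ?thesis by simp
qed

text \<open>
  The generating function \<open>\<phi>\<close> satisfies \<open>\<phi>(nh) = \<phi>(h)\<^sup>n\<close> and \<open>\<phi>(h) - exp (- c h) = o(h)\<close>. For numbers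
  of modulus at most one, \<open>n\<close>-th powers differ by at most \<open>n\<close> times the difference of the bases, so
  \<open>h = t / n\<close> and \<open>n \<rightarrow> \<infinity>\<close> give \<open>\<phi>(t) = exp (- c t)\<close>.
\<close>
lemma (in prob_space) generalized_counting_process_pgf:
  assumes N: "generalized_counting_process M k rate N"
    and rate: "\<And>j. j \<in> {1..k} \<Longrightarrow> 0 < rate j" and u: "\<bar>u\<bar> \<le> 1" and t: "0 \<le> t"
  shows "expectation (\<lambda>\<omega>. u ^ N t \<omega>) = exp (- (\<Sum>j=1..k. rate j * (1 - u ^ j)) * t)"
proof -
  define c where "c = (\<Sum>j=1..k. rate j * (1 - u ^ j))"
  define \<phi> where "\<phi> = (\<lambda>t. expectation (\<lambda>\<omega>. u ^ N t \<omega>))"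
  have N': "counting_process M N" "AE \<omega> in M. N 0 \<omega> = 0"
    "independent_increments M (\<lambda>t \<omega>. real (N t \<omega>))"
    "stationary_increments M (\<lambda>t \<omega>. real (N t \<omega>))"
    and rate_lim: "\<And>j. j \<in> {1..k} \<Longrightarrow> (\<lambda>h. prob {\<omega> \<in> space M. N h \<omega> = j} - rate j * h) \<in> o[at_right 0](\<lambda>h. h)"
    and large: "(\<lambda>h. prob {\<omega> \<in> space M. N h \<omega> > k}) \<in> o[at_right 0](\<lambda>h. h)"
    using N unfolding generalized_counting_process_def by blast+
  have N_meas: "random_variable (count_space UNIV) (N t)" if "0 \<le> t" for t
    using N'(1) that by (simp add: counting_process_def)
  have power_le: "\<bar>u ^ n\<bar> \<le> 1" for n using u by (simp add: power_abs power_le_one)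
  have c: "0 \<le> c"
  proof -
    have "u ^ j \<le> 1" for j using power_le[of j] by simp
    then show ?thesis
      unfolding c_def using rate by (intro sum_nonneg mult_nonneg_nonneg) (auto intro: less_imp_le)
  qed
  have \<phi>_0: "\<phi> 0 = 1"
  proof -
    note N_meas[OF order_refl, measurable]
    have "\<phi> 0 = expectation (\<lambda>\<omega>. 1)"
      unfolding \<phi>_def
      by (rule integral_cong_AE) (use N'(2) in \<open>auto elim: eventually_mono\<close>)
    then show ?thesis by (simp add: prob_space)
  qed
  have \<phi>_bound: "\<bar>\<phi> t\<bar> \<le> 1" if "0 \<le> t" for t
  proof -
    note N_meas[OF that, measurable]
    have "\<bar>\<phi> t\<bar> \<le> expectation (\<lambda>\<omega>. \<bar>u ^ N t \<omega>\<bar>)"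
      unfolding \<phi>_def by (rule integral_abs_bound)
    also have "\<dots> \<le> expectation (\<lambda>\<omega>. 1)"
      using power_le by (intro integral_mono integrable_const_bound[where B = 1]) auto
    finally show ?thesis by (simp add: prob_space)
  qed
  have \<phi>_power: "\<phi> (real n * h) = \<phi> h ^ n" if "0 \<le> h" for n h
  proof (induction n)
    case (Suc n)
    have "\<phi> (h + real n * h) = \<phi> h * \<phi> (real n * h)"
      unfolding \<phi>_def using indep_increments_pgf_mult[OF N' u that, of "real n * h"] that by simp
    with Suc show ?case by (simp add: algebra_simps)
  qed (simp add: \<phi>_0)
  have local_expansion: "\<bar>\<phi> h - 1 + (\<Sum>j=1..k. (1 - u ^ j) * prob {\<omega> \<in> space M. N h \<omega> = j})\<bar>
      \<le> 2 * prob {\<omega> \<in> space M. N h \<omega> > k}" if "0 \<le> h" for h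
  proof -
    note N_meas[OF that, measurable]
    define J where "J = (\<lambda>\<omega>. \<Sum>j=1..k. (1 - u ^ j) * indicator {\<omega> \<in> space M. N h \<omega> = j} \<omega>)"
    have int: "integrable M (\<lambda>\<omega>. u ^ N h \<omega>)"
      using power_le by (intro integrable_const_bound[where B = 1]) auto
    have J_int: "integrable M J" unfolding J_def by (intro Bochner_Integration.integrable_sum integrable_mult_right) (auto intro!: integrable_real_indicator simp: emeasure_eq_measure)
    have "expectation (indicator {\<omega> \<in> space M. N h \<omega> = j}) = prob {\<omega> \<in> space M. N h \<omega> = j}" for j
      by simp
    then have "expectation J = (\<Sum>j=1..k. (1 - u ^ j) * prob {\<omega> \<in> space M. N h \<omega> = j})"
      unfolding J_def
      by (subst Bochner_Integration.integral_sum) (auto intro!: integrable_mult_right integrable_real_indicator simp: emeasure_eq_measure)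
    then have "\<phi> h - 1 + (\<Sum>j=1..k. (1 - u ^ j) * prob {\<omega> \<in> space M. N h \<omega> = j}) =
        expectation (\<lambda>\<omega>. u ^ N h \<omega> - 1 + J \<omega>)"
      using int J_int by (simp add: \<phi>_def prob_space)
    also have "\<bar>\<dots>\<bar> \<le> expectation (\<lambda>\<omega>. \<bar>u ^ N h \<omega> - 1 + J \<omega>\<bar>)"
      by (rule integral_abs_bound)
    also have "\<dots> \<le> expectation (\<lambda>\<omega>. 2 * indicator {\<omega> \<in> space M. N h \<omega> > k} \<omega>)"
    proof (rule integral_mono)
      show "integrable M (\<lambda>\<omega>. \<bar>u ^ N h \<omega> - 1 + J \<omega>\<bar>)" using int J_int by auto
      show "integrable M (\<lambda>\<omega>. 2 * indicator {\<omega> \<in> space M. N h \<omega> > k} \<omega> :: real)"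
        by (intro integrable_mult_right) (auto intro!: integrable_real_indicator simp: emeasure_eq_measure)
      fix \<omega> assume \<omega>: "\<omega> \<in> space M"
      have J_eq: "J \<omega> = (if N h \<omega> \<in> {1..k} then 1 - u ^ N h \<omega> else 0)"
      proof -
        have "J \<omega> = (\<Sum>j=1..k. if j = N h \<omega> then 1 - u ^ j else 0)"
          unfolding J_def using \<omega> by (intro sum.cong) auto
        then show ?thesis by simp
      qed
      show "\<bar>u ^ N h \<omega> - 1 + J \<omega>\<bar> \<le> 2 * indicator {\<omega> \<in> space M. N h \<omega> > k} \<omega>"
      proof (cases "N h \<omega> > k")
        case True
        then show ?thesis using power_le[of "N h \<omega>"] \<omega> by (simp add: J_eq)
      next
        case False
        then show ?thesis using \<omega> by (cases "N h \<omega> = 0") (auto simp: J_eq)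
      qed
    qed
    finally show ?thesis by simp
  qed
  \<comment> \<open>The remainder \<open>r\<close> collects the jumps larger than \<open>k\<close>.\<close>
  define r where "r = (\<lambda>h. \<phi> h - 1 + (\<Sum>j=1..k. (1 - u ^ j) * prob {\<omega> \<in> space M. N h \<omega> = j}))"
  have r_lim: "((\<lambda>h. r h / h) \<longlongrightarrow> 0) (at_right 0)"
  proof (rule Lim_null_comparison)
    show "((\<lambda>h. 2 * (prob {\<omega> \<in> space M. N h \<omega> > k} / h)) \<longlongrightarrow> 0) (at_right 0)"
      using tendsto_mult_right_zero[OF smalloD_tendsto[OF large], of 2] by simp
    show "\<forall>\<^sub>F h in at_right 0. norm (r h / h) \<le> 2 * (prob {\<omega> \<in> space M. N h \<omega> > k} / h)"
      using eventually_at_right_less[of 0]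
    proof eventually_elim
      case (elim h)
      then show ?case using local_expansion[of h] by (simp add: r_def divide_right_mono)
    qed
  qed
  have exp_lim: "((\<lambda>h. (exp (- c * h) - 1) / h) \<longlongrightarrow> - c) (at_right 0)"
  proof -
    have "((\<lambda>h. exp (- c * h)) has_real_derivative - c) (at 0)"
      by (auto intro!: derivative_eq_intros)
    then have "((\<lambda>h. (exp (- c * h) - 1) / h) \<longlongrightarrow> - c) (at 0)"
      by (simp add: DERIV_def)
    then show ?thesis by (rule filterlim_mono) (auto simp: at_within_le_at)
  qed
  have "((\<lambda>h. r h / h - (\<Sum>j=1..k. (1 - u ^ j) * ((prob {\<omega> \<in> space M. N h \<omega> = j} - rate j * h) / h))
      - (exp (- c * h) - 1) / h - c) \<longlongrightarrow> 0 - (\<Sum>j=1..k. (1 - u ^ j) * 0) - (- c) - c) (at_right 0)"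
    by (intro tendsto_intros r_lim exp_lim smalloD_tendsto[OF rate_lim])
  moreover have "0 - (\<Sum>j=1..k. (1 - u ^ j) * 0) - (- c) - c = 0" by simp
  ultimately have "((\<lambda>h. r h / h - (\<Sum>j=1..k. (1 - u ^ j) * ((prob {\<omega> \<in> space M. N h \<omega> = j} - rate j * h) / h))
      - (exp (- c * h) - 1) / h - c) \<longlongrightarrow> 0) (at_right 0)"
    by metis
  then have lim: "((\<lambda>h. (\<phi> h - exp (- c * h)) / h) \<longlongrightarrow> 0) (at_right 0)"
  proof (rule Lim_transform_eventually)
    show "\<forall>\<^sub>F h in at_right 0. r h / h - (\<Sum>j=1..k. (1 - u ^ j) * ((prob {\<omega> \<in> space M. N h \<omega> = j} - rate j * h) / h))
      - (exp (- c * h) - 1) / h - c = (\<phi> h - exp (- c * h)) / h"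
      using eventually_at_right_less[of 0]
    proof eventually_elim
      case (elim h)
      have "(\<Sum>j=1..k. (1 - u ^ j) * ((prob {\<omega> \<in> space M. N h \<omega> = j} - rate j * h) / h)) =
         (\<Sum>j=1..k. (1 - u ^ j) * prob {\<omega> \<in> space M. N h \<omega> = j}) / h - c"
        using elim by (simp add: c_def sum_divide_distrib flip: sum_subtractf)
          (intro sum.cong, auto simp: field_simps)
      then show ?case
        unfolding r_def by (simp only: diff_divide_distrib add_divide_distrib)
    qed
  qed
  have "\<phi> t = exp (- c * t)"
  proof (cases "t = 0")
    case False
    with t have t: "0 < t" by simp
    have "filterlim (\<lambda>n. t / real (Suc n)) (at_right 0) sequentially"
      using t by (intro tendsto_imp_filterlim_at_right LIMSEQ_Suc[OF lim_const_over_n])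
        (auto intro!: always_eventually)
    from filterlim_compose[OF lim this]
    have "(\<lambda>n. t * \<bar>(\<phi> (t / real (Suc n)) - exp (- c * (t / real (Suc n)))) / (t / real (Suc n))\<bar>) \<longlonglongrightarrow> t * 0"
      by (intro tendsto_mult tendsto_const tendsto_rabs_zero)
    moreover have "\<bar>\<phi> t - exp (- c * t)\<bar>
        \<le> t * \<bar>(\<phi> (t / real (Suc n)) - exp (- c * (t / real (Suc n)))) / (t / real (Suc n))\<bar>" for n
    proof -
      define h where "h = t / real (Suc n)"
      have h: "0 < h" "real (Suc n) * h = t" using t by (simp_all add: h_def del: of_nat_Suc)
      have "\<phi> t = \<phi> h ^ Suc n" using \<phi>_power[of h "Suc n"] h by simp
      moreover have "exp (- c * t) = exp (real (Suc n) * (- c * h))"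
        unfolding h(2)[symmetric] by (simp only: mult.left_commute)
      then have "exp (- c * t) = exp (- c * h) ^ Suc n" by (simp only: exp_of_nat_mult)
      ultimately have "norm (\<phi> t - exp (- c * t)) \<le> real (Suc n) * norm (\<phi> h - exp (- c * h))"
        using norm_power_diff[of "\<phi> h" "exp (- c * h)" "Suc n"] \<phi>_bound[of h] c h(1) by simp
      also have "\<dots> = t * \<bar>(\<phi> h - exp (- c * h)) / h\<bar>"
        using h by (simp add: abs_divide field_simps del: of_nat_Suc)
      finally show ?thesis by (simp add: h_def)
    qed
    ultimately have "\<bar>\<phi> t - exp (- c * t)\<bar> \<le> t * 0"
      by (intro LIMSEQ_le_const) auto
    then show ?thesis by simp
  qed (simp add: \<phi>_0)
  then show ?thesis by (simp add: \<phi>_def c_def)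
qed

text \<open>
  The process \<open>N\<close> and the time \<open>T\<close> are independent only for each fixed time of \<open>N\<close>, and \<open>N\<close> need not
  be measurable jointly in time and sample point. Therefore \<open>T\<close> is replaced by the discrete times
  \<open>(\<lfloor>(m + 1) T\<rfloor> + 1) / (m + 1)\<close>; they lie strictly above \<open>T\<close> and tend to \<open>T\<close>, so that
  right-continuity of the integer-valued paths makes \<open>N\<close> at these times eventually equal to its value
  at \<open>T\<close>.
\<close>
lemma (in prob_space) counting_process_subordination:
  fixes T :: "'a \<Rightarrow> real"
  assumes N: "counting_process M N"
    and T[measurable]: "random_variable borel T" and T_nonneg: "\<And>\<omega>. 0 \<le> T \<omega>"
    and indep: "\<And>s. 0 \<le> s \<Longrightarrow> indep_var borel (\<lambda>\<omega>. real (N s \<omega>)) borel T"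
    and u: "\<bar>u\<bar> \<le> 1"
    and pgf: "\<And>s. 0 \<le> s \<Longrightarrow> expectation (\<lambda>\<omega>. u ^ N s \<omega>) = exp (- c * s)" and c: "0 \<le> c"
  shows "random_variable (count_space UNIV) (\<lambda>\<omega>. N (T \<omega>) \<omega>)"
    and "expectation (\<lambda>\<omega>. u ^ N (T \<omega>) \<omega>) = expectation (\<lambda>\<omega>. exp (- c * T \<omega>))"
proof -
  have N_meas: "random_variable (count_space UNIV) (N t)" if "0 \<le> t" for t
    using N that by (simp add: counting_process_def)
  have power_le: "\<bar>u ^ n\<bar> \<le> 1" for n using u by (simp add: power_abs power_le_one)
  define K where "K = (\<lambda>m \<omega>. nat \<lfloor>real (Suc m) * T \<omega>\<rfloor>)"
  define d where "d = (\<lambda>m j. real (Suc j) / real (Suc m))"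
  have K_meas[measurable]: "random_variable (count_space UNIV) (K m)" for m unfolding K_def by measurable
  have d_nonneg: "0 \<le> d m j" for m j by (simp add: d_def)
  have N_d_meas[measurable]: "random_variable (count_space UNIV) (N (d m j))" for m j
    by (rule N_meas[OF d_nonneg])
  have d_K: "T \<omega> < d m (K m \<omega>)" "d m (K m \<omega>) \<le> T \<omega> + 1 / real (Suc m)" for m \<omega>
  proof -
    define y where "y = real (Suc m) * T \<omega>"
    have y: "0 \<le> y" "T \<omega> = y / real (Suc m)" using T_nonneg[of \<omega>] by (simp_all add: y_def del: of_nat_Suc)
    have K: "real (K m \<omega>) = of_int \<lfloor>y\<rfloor>"
      using y(1) by (simp add: K_def y_def of_nat_nat del: of_nat_Suc)
    have "y < real (Suc (K m \<omega>))" "real (Suc (K m \<omega>)) \<le> y + 1" using K by (simp_all) linarith+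
    then have "y / real (Suc m) < real (Suc (K m \<omega>)) / real (Suc m)"
      "real (Suc (K m \<omega>)) / real (Suc m) \<le> (y + 1) / real (Suc m)"
      by (intro divide_strict_right_mono divide_right_mono; simp)+
    then show "T \<omega> < d m (K m \<omega>)" "d m (K m \<omega>) \<le> T \<omega> + 1 / real (Suc m)"
      unfolding d_def y(2) by (simp_all add: add_divide_distrib)
  qed
  have d_lim: "(\<lambda>m. d m (K m \<omega>)) \<longlonglongrightarrow> T \<omega>" for \<omega>
  proof (rule tendsto_sandwich[OF _ _ tendsto_const])
    have "(\<lambda>m. T \<omega> + 1 / real (Suc m)) \<longlonglongrightarrow> T \<omega> + 0"
      by (intro tendsto_intros LIMSEQ_Suc lim_1_over_n)
    then show "(\<lambda>m. T \<omega> + 1 / real (Suc m)) \<longlonglongrightarrow> T \<omega>" by simp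
    show "\<forall>\<^sub>F m in sequentially. T \<omega> \<le> d m (K m \<omega>)"
      "\<forall>\<^sub>F m in sequentially. d m (K m \<omega>) \<le> T \<omega> + 1 / real (Suc m)"
      using d_K by (auto intro!: always_eventually less_imp_le simp del: of_nat_Suc)
  qed
  have N_lim: "(\<lambda>m. real (N (d m (K m \<omega>)) \<omega>)) \<longlonglongrightarrow> real (N (T \<omega>) \<omega>)" if "\<omega> \<in> space M" for \<omega>
  proof -
    have "filterlim (\<lambda>m. d m (K m \<omega>)) (at_right (T \<omega>)) sequentially"
      using d_lim d_K(1) by (intro tendsto_imp_filterlim_at_right) (auto intro!: always_eventually)
    moreover have "((\<lambda>s. real (N s \<omega>)) \<longlongrightarrow> real (N (T \<omega>) \<omega>)) (at_right (T \<omega>))"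
      using N that T_nonneg[of \<omega>] by (auto simp: counting_process_def continuous_within)
    ultimately show ?thesis by (rule filterlim_compose[rotated])
  qed
  have N_eventually: "\<forall>\<^sub>F m in sequentially. N (d m (K m \<omega>)) \<omega> = N (T \<omega>) \<omega>" if "\<omega> \<in> space M" for \<omega>
    using tendstoD[OF N_lim[OF that], of 1] by (auto simp: dist_real_def elim!: eventually_mono)
  have real_meas: "(\<lambda>\<omega>. real (N (T \<omega>) \<omega>)) \<in> borel_measurable M"
  proof (rule borel_measurable_LIMSEQ_real[OF N_lim])
    show "(\<lambda>\<omega>. real (N (d m (K m \<omega>)) \<omega>)) \<in> borel_measurable M" for m
      by (rule measurable_compose_countable[of "\<lambda>j \<omega>. real (N (d m j) \<omega>)", OF _ K_meas]) measurable
  qed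
  show N_T_meas[measurable]: "random_variable (count_space UNIV) (\<lambda>\<omega>. N (T \<omega>) \<omega>)"
    unfolding measurable_count_space_eq2_countable
  proof safe
    fix n :: nat
    have "(\<lambda>\<omega>. N (T \<omega>) \<omega>) -` {n} \<inter> space M = (\<lambda>\<omega>. real (N (T \<omega>) \<omega>)) -` {real n} \<inter> space M" by auto
    also have "\<dots> \<in> sets M" by (rule measurable_sets[OF real_meas]) simp
    finally show "(\<lambda>\<omega>. N (T \<omega>) \<omega>) -` {n} \<inter> space M \<in> sets M" .
  qed simp
  \<comment> \<open>On the event that the discrete time has its \<open>j\<close>-th value, independence factors the expectation.\<close>
  have discrete: "expectation (\<lambda>\<omega>. u ^ N (d m (K m \<omega>)) \<omega>) = expectation (\<lambda>\<omega>. exp (- c * d m (K m \<omega>)))" for m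
  proof (rule sums_unique2)
    show "(\<lambda>j. expectation (\<lambda>\<omega>. indicator {j} (K m \<omega>) * u ^ N (d m j) \<omega>)) sums
        expectation (\<lambda>\<omega>. u ^ N (d m (K m \<omega>)) \<omega>)"
      using power_le by (intro expectation_split_nat_sums[where B = 1]) auto
    have "(\<lambda>j. expectation (\<lambda>\<omega>. indicator {j} (K m \<omega>) * exp (- c * d m j))) sums
        expectation (\<lambda>\<omega>. exp (- c * d m (K m \<omega>)))"
      using c d_nonneg by (intro expectation_split_nat_sums[where B = 1]) auto
    moreover have "expectation (\<lambda>\<omega>. indicator {j} (K m \<omega>) * u ^ N (d m j) \<omega>) =
        expectation (\<lambda>\<omega>. indicator {j} (K m \<omega>) * exp (- c * d m j))" for j
    proof -
      define f where "f = (\<lambda>y::real. u ^ nat \<lfloor>y\<rfloor>)"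
      define g where "g = (\<lambda>y. indicator {j} (nat \<lfloor>real (Suc m) * y\<rfloor>) :: real)"
      have [measurable]: "f \<in> borel_measurable borel" "g \<in> borel_measurable borel"
        unfolding f_def g_def by measurable
      have "indep_var borel (\<lambda>\<omega>. f (real (N (d m j) \<omega>))) borel (\<lambda>\<omega>. g (T \<omega>))"
        using indep_var_compose[OF indep[OF d_nonneg], of f borel g borel] by (simp add: comp_def)
      then have "expectation (\<lambda>\<omega>. f (real (N (d m j) \<omega>)) * g (T \<omega>)) =
          expectation (\<lambda>\<omega>. f (real (N (d m j) \<omega>))) * expectation (\<lambda>\<omega>. g (T \<omega>))"
        using power_le
        by (intro indep_var_lebesgue_integral integrable_const_bound[where B = 1])
          (auto simp: f_def g_def indicator_def)
      then show ?thesis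
        using pgf[OF d_nonneg] by (simp add: f_def g_def K_def mult.commute)
    qed
    ultimately show "(\<lambda>j. expectation (\<lambda>\<omega>. indicator {j} (K m \<omega>) * u ^ N (d m j) \<omega>)) sums
        expectation (\<lambda>\<omega>. exp (- c * d m (K m \<omega>)))"
      by simp
  qed
  have "(\<lambda>m. expectation (\<lambda>\<omega>. u ^ N (d m (K m \<omega>)) \<omega>)) \<longlonglongrightarrow> expectation (\<lambda>\<omega>. u ^ N (T \<omega>) \<omega>)"
  proof (rule integral_dominated_convergence[where w = "\<lambda>_. 1"])
    show "(\<lambda>\<omega>. u ^ N (d m (K m \<omega>)) \<omega>) \<in> borel_measurable M" for m
      by (rule measurable_compose_countable[of "\<lambda>j \<omega>. u ^ N (d m j) \<omega>", OF _ K_meas]) measurable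
    show "AE \<omega> in M. (\<lambda>m. u ^ N (d m (K m \<omega>)) \<omega>) \<longlonglongrightarrow> u ^ N (T \<omega>) \<omega>"
      by (intro AE_I2 tendsto_eventually eventually_mono[OF N_eventually]) auto
  qed (use power_le in auto)
  moreover have "(\<lambda>m. expectation (\<lambda>\<omega>. exp (- c * d m (K m \<omega>)))) \<longlonglongrightarrow> expectation (\<lambda>\<omega>. exp (- c * T \<omega>))"
  proof (rule integral_dominated_convergence[where w = "\<lambda>_. 1"])
    show "(\<lambda>\<omega>. exp (- c * d m (K m \<omega>))) \<in> borel_measurable M" for m
      by (rule measurable_compose_countable[of "\<lambda>j \<omega>. exp (- c * d m j)", OF _ K_meas]) measurable
    show "AE \<omega> in M. (\<lambda>m. exp (- c * d m (K m \<omega>))) \<longlonglongrightarrow> exp (- c * T \<omega>)"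
      using d_lim by (intro AE_I2 tendsto_intros)
  qed (use c d_nonneg in auto)
  ultimately show "expectation (\<lambda>\<omega>. u ^ N (T \<omega>) \<omega>) = expectation (\<lambda>\<omega>. exp (- c * T \<omega>))"
    unfolding discrete by (rule LIMSEQ_unique)
qed

section \<open>The time-changed generating function\<close>

lemma (in subordinator_pair) laplace_inverse_process_0:
  "laplace_process M (inverse_process \<nu> lam H1 H2) \<gamma> 0 = 1"
  by (simp add: laplace_process_def inverse_process_def prob_space)

text \<open>
  The abscissa \<open>\<sigma>\<close> is chosen so large that the transform of the series converges from \<open>\<sigma>\<close> on.
\<close>
lemma (in subordinator_pair) laplace_inverse_process_eq_series:
  assumes meas: "\<And>t. 0 < t \<Longrightarrow> random_variable borel (inverse_process \<nu> lam H1 H2 t)"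
    and \<gamma>: "0 < \<gamma>" and t: "0 \<le> t"
  shows "laplace_process M (inverse_process \<nu> lam H1 H2) \<gamma> t =
    fractional_power_series \<nu> (telegraph_coeff lam \<gamma>) t"
proof (cases "t = 0")
  case True
  then show ?thesis using laplace_inverse_process_0 fractional_power_series_0[OF \<nu>] by simp
next
  case False
  with t have t: "0 < t" by simp
  define R where "R = 1 + 2 * lam + \<gamma>"
  define \<sigma> where "\<sigma> = (R + 1) powr (1 / \<nu>)"
  have R: "0 < R" using lam \<gamma> by (simp add: R_def)
  have \<sigma>: "0 < \<sigma>" "\<sigma> powr \<nu> = R + 1" using R \<nu> by (simp_all add: \<sigma>_def powr_powr)
  let ?l = "laplace_process M (inverse_process \<nu> lam H1 H2) \<gamma>"
  let ?g = "fractional_power_series \<nu> (telegraph_coeff lam \<gamma>)"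
  define f where "f = (\<lambda>t. ?l t - ?g t)"
  have transform: "has_bochner_integral lborel (\<lambda>t. indicator {0<..} t * (exp (- (s * t)) * f t)) 0"
    if "\<sigma> \<le> s" for s
  proof -
    have s: "0 < s" "1 + 2 * lam + \<gamma> < s powr \<nu>"
      using that \<sigma> powr_mono2[of \<nu> \<sigma> s] \<nu> by (auto simp: R_def)
    show ?thesis
      using has_bochner_integral_diff[OF inverse_process_laplace(2)[OF meas \<gamma> s(1)]
          telegraph_relaxation_laplace[OF \<nu> lam \<gamma> s]]
      by (simp add: f_def clock_exponent_def right_diff_distrib)
  qed
  have "f t = 0"
  proof (rule laplace_transform_zero_imp_zero[where f = f and t = t and \<sigma> = \<sigma>])
    show "integrable lborel (\<lambda>t. indicator {0<..} t * (exp (- (\<sigma> * t)) * f t))"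
      using transform[of \<sigma>] by (simp add: has_bochner_integral_iff)
    show "(\<integral>t. indicator {0<..} t * (exp (- ((\<sigma> + real n) * t)) * f t) \<partial>lborel) = 0" for n
      using transform[of "\<sigma> + real n"] by (simp add: has_bochner_integral_iff)
    show "(f \<longlongrightarrow> f t) (at_left t)" if "0 < t" for t
    proof -
      have "isCont ?g t"
        using fractional_power_series_has_deriv(1)[OF \<nu> telegraph_coeff_bound[OF lam \<gamma>] that]
        by (rule DERIV_isCont)
      then have "(?g \<longlongrightarrow> ?g t) (at_left t)"
        by (auto simp: isCont_def intro: filterlim_mono at_within_le_at)
      then show ?thesis
        unfolding f_def using inverse_process_laplace(1)[OF meas \<gamma> that] by (intro tendsto_diff)
    qed
  qed (rule t)
  then show ?thesis by (simp add: f_def)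
qed

lemma (in prob_space) time_changed_pgf_eq_laplace_process:
  assumes N: "generalized_counting_process M k rate N"
    and rate: "\<And>j. j \<in> {1..k} \<Longrightarrow> 0 < rate j" and u: "\<bar>u\<bar> \<le> 1"
    and L: "random_variable borel (L t)" "\<And>\<omega>. 0 \<le> L t \<omega>"
    and indep: "\<And>s. 0 \<le> s \<Longrightarrow> indep_var borel (\<lambda>\<omega>. real (N s \<omega>)) borel (L t)"
  shows "time_changed_pgf M N L u t = laplace_process M L (\<Sum>j=1..k. rate j * (1 - u ^ j)) t"
proof -
  define c where "c = (\<Sum>j=1..k. rate j * (1 - u ^ j))"
  have power_le: "\<bar>u ^ n\<bar> \<le> 1" for n using u by (simp add: power_abs power_le_one)
  then have "u ^ n \<le> 1" for n using abs_le_D1 by blast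
  then have c: "0 \<le> c"
    unfolding c_def using rate by (intro sum_nonneg mult_nonneg_nonneg) (auto intro: less_imp_le)
  have "counting_process M N" using N by (simp add: generalized_counting_process_def)
  note sub = counting_process_subordination[OF this L indep u
      generalized_counting_process_pgf[OF N rate u, folded c_def] c]
  note [measurable] = sub(1)
  have "expectation (\<lambda>\<omega>. indicator {n} (N (L t \<omega>) \<omega>) * u ^ n) = u ^ n * time_changed_prob M N L n t" for n
  proof -
    have "expectation (\<lambda>\<omega>. indicator {n} (N (L t \<omega>) \<omega>) :: real) =
        expectation (indicator {\<omega> \<in> space M. N (L t \<omega>) \<omega> = n})"
      by (intro Bochner_Integration.integral_cong) (auto simp: indicator_def)
    then show ?thesis by (simp add: time_changed_prob_def mult.commute)
  qed
  moreover have "(\<lambda>n. expectation (\<lambda>\<omega>. indicator {n} (N (L t \<omega>) \<omega>) * u ^ n)) sums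
      expectation (\<lambda>\<omega>. u ^ N (L t \<omega>) \<omega>)"
    using power_le by (intro expectation_split_nat_sums[where B = 1] sub(1)) auto
  ultimately have "(\<lambda>n. u ^ n * time_changed_prob M N L n t) sums expectation (\<lambda>\<omega>. u ^ N (L t \<omega>) \<omega>)"
    by (simp only:)
  then show ?thesis
    using sub(2) by (simp add: time_changed_pgf_def laplace_process_def sums_iff c_def)
qed

theorem theorem11:
  fixes P :: "'a measure"
    and \<nu> lam :: real
    and k :: nat
    and rate :: "nat \<Rightarrow> real"
    and H1 H2 :: "real \<Rightarrow> 'a \<Rightarrow> real"
    and M :: "real \<Rightarrow> 'a \<Rightarrow> nat"
  assumes "prob_space P"
    and "0 < \<nu>" "\<nu> \<le> 1 / 2"
    and "lam > 0"
    and "k \<ge> 1"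
    and "\<And>j. j \<in> {1..k} \<Longrightarrow> rate j > 0"
    and "generalized_counting_process P k rate M"
    and "stable_subordinator P (2 * \<nu>) H1"
    and "stable_subordinator P \<nu> H2"
    and "independent_processes P H1 H2"
    and "independent_processes P (\<lambda>t \<omega>. real (M t \<omega>)) (inverse_process \<nu> lam H1 H2)"
  shows
    "(\<forall>u::real. \<bar>u\<bar> < 1 \<longrightarrow>
        (\<forall>t>0.
           caputo_differentiable (2 * \<nu>)
             (time_changed_pgf P M (inverse_process \<nu> lam H1 H2) u) t \<and>
           caputo_differentiable \<nu>
             (time_changed_pgf P M (inverse_process \<nu> lam H1 H2) u) t \<and>
           caputo_deriv (2 * \<nu>) (time_changed_pgf P M (inverse_process \<nu> lam H1 H2) u) t
             + 2 * lam * caputo_deriv \<nu> (time_changed_pgf P M (inverse_process \<nu> lam H1 H2) u) t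
           = - (\<Sum>j=1..k. rate j * (1 - u ^ j))
               * time_changed_pgf P M (inverse_process \<nu> lam H1 H2) u t) \<and>
        time_changed_pgf P M (inverse_process \<nu> lam H1 H2) u 0 = 1 \<and>
        (\<forall>t\<ge>0. time_changed_pgf P M (inverse_process \<nu> lam H1 H2) u t =
           laplace_process P (inverse_process \<nu> lam H1 H2) (\<Sum>j=1..k. rate j * (1 - u ^ j)) t)) \<and>
     (\<forall>\<gamma>>0. \<forall>t\<ge>0. \<forall>w r1 r2 :: complex.
        w\<^sup>2 = of_real (lam\<^sup>2 - \<gamma>) \<and> r1 = - of_real lam + w \<and> r2 = - of_real lam - w \<longrightarrow>
        (\<gamma> \<noteq> lam\<^sup>2 \<longrightarrow>
           of_real (laplace_process P (inverse_process \<nu> lam H1 H2) \<gamma> t) =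
             1 / 2 * ((1 + of_real lam / w) * mittag_leffler \<nu> 1 (r1 * of_real (t powr \<nu>))
                    + (1 - of_real lam / w) * mittag_leffler \<nu> 1 (r2 * of_real (t powr \<nu>)))) \<and>
        of_real (laplace_process P (inverse_process \<nu> lam H1 H2) \<gamma> t) =
          mittag_leffler2 \<nu> 1 1 1 (r1 * of_real (t powr \<nu>)) (r2 * of_real (t powr \<nu>))
          + 2 * of_real lam * of_real (t powr \<nu>)
            * mittag_leffler2 \<nu> (\<nu> + 1) 1 1 (r1 * of_real (t powr \<nu>)) (r2 * of_real (t powr \<nu>)))"
proof -
  interpret prob_space P by fact
  interpret subordinator_pair P \<nu> lam H1 H2
    by unfold_locales (use assms in auto)
  let ?L = "inverse_process \<nu> lam H1 H2"
  let ?G = "time_changed_pgf P M ?L"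
  have indep: "indep_var borel (\<lambda>\<omega>. real (M s \<omega>)) borel (?L t)" if "0 \<le> s" "0 \<le> t" for s t
    using independent_processes_imp_indep_var[OF assms(11) that] .
  have L_meas: "random_variable borel (?L t)" if "0 \<le> t" for t
    using indep[OF order_refl that] by (rule indep_var_rv2)
  have laplace: "laplace_process P ?L \<gamma> t = fractional_power_series \<nu> (telegraph_coeff lam \<gamma>) t"
    if "0 < \<gamma>" "0 \<le> t" for \<gamma> t
    by (rule laplace_inverse_process_eq_series[OF L_meas[OF less_imp_le] that])
  have part1: "(\<forall>t>0. caputo_differentiable (2 * \<nu>) (?G u) t \<and> caputo_differentiable \<nu> (?G u) t \<and>
      caputo_deriv (2 * \<nu>) (?G u) t + 2 * lam * caputo_deriv \<nu> (?G u) t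
        = - (\<Sum>j=1..k. rate j * (1 - u ^ j)) * ?G u t) \<and>
      ?G u 0 = 1 \<and> (\<forall>t\<ge>0. ?G u t = laplace_process P ?L (\<Sum>j=1..k. rate j * (1 - u ^ j)) t)"
    if u: "\<bar>u\<bar> < 1" for u :: real
  proof -
    define c where "c = (\<Sum>j=1..k. rate j * (1 - u ^ j))"
    have c: "0 < c"
      unfolding c_def
    proof (rule sum_pos)
      fix j assume j: "j \<in> {1..k}"
      have "\<bar>u ^ j\<bar> \<le> \<bar>u\<bar> ^ 1"
        unfolding power_abs using u j by (intro power_decreasing) auto
      then have "u ^ j < 1" using u by simp
      then show "0 < rate j * (1 - u ^ j)" using assms(6)[OF j] by simp
    qed (use assms(5) in auto)
    have pgf: "?G u t = laplace_process P ?L c t" if "0 \<le> t" for t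
      unfolding c_def using assms(6) u L_meas[OF that] inverse_process_nonneg indep[OF _ that]
      by (intro time_changed_pgf_eq_laplace_process[OF assms(7)]) auto
    have G: "?G u t = fractional_power_series \<nu> (telegraph_coeff lam c) t" if "0 \<le> t" for t
      using pgf[OF that] laplace[OF c that] by simp
    note caputo = telegraph_relaxation_caputo[OF \<nu> lam c assms(3) G]
    show ?thesis
      unfolding c_def[symmetric]
      using caputo pgf laplace_inverse_process_0 by simp
  qed
  have part2: "(\<gamma> \<noteq> lam\<^sup>2 \<longrightarrow>
           of_real (laplace_process P ?L \<gamma> t) =
             1 / 2 * ((1 + of_real lam / w) * mittag_leffler \<nu> 1 (r1 * of_real (t powr \<nu>))
                    + (1 - of_real lam / w) * mittag_leffler \<nu> 1 (r2 * of_real (t powr \<nu>)))) \<and>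
        of_real (laplace_process P ?L \<gamma> t) =
          mittag_leffler2 \<nu> 1 1 1 (r1 * of_real (t powr \<nu>)) (r2 * of_real (t powr \<nu>))
          + 2 * of_real lam * of_real (t powr \<nu>)
            * mittag_leffler2 \<nu> (\<nu> + 1) 1 1 (r1 * of_real (t powr \<nu>)) (r2 * of_real (t powr \<nu>))"
    if "0 < \<gamma>" "0 \<le> t" and w: "w\<^sup>2 = of_real (lam\<^sup>2 - \<gamma>)"
      and r: "r1 = - of_real lam + w" "r2 = - of_real lam - w" for \<gamma> t :: real and w r1 r2 :: complex
  proof -
    have "w \<noteq> 0" if "\<gamma> \<noteq> lam\<^sup>2"
      using w that by (auto simp: of_real_eq_0_iff simp del: of_real_diff of_real_power)
    then show ?thesis
      using telegraph_relaxation_mittag_leffler[OF \<nu> lam \<open>0 < \<gamma>\<close> w r, of t] laplace[OF that(1,2)]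
      by simp
  qed
  show ?thesis
    using part1 part2 by blast
qed

end
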